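(* For $\theta\in(0,1)$ and $n\in\mathbb{N}$, $$\Theta(2,\theta,n)=(n+2)^{1-\theta}.$$ Moreover, $\Theta(2,\theta,n)$ is achieved at $\nu\in\mathcal{M}_2^c(\mathbb{S}^n)$ if and only if $$\nu=\frac{1}{n+2}\sum_{i=1}^{n+2}\delta_{\xi_i}$$ for some $\xi_1,\dots,\xi_{n+2}\in\mathbb{S}^n$ which are the vertices of a regular $(n+1)$-simplex embedded in the unit ball.
   Context: $\mathbb{S}^n\subset\mathbb{R}^{n+1}$ is the unit sphere and $\mu$ its standard measure. For $m\in\mathbb{N}$, $\overset{\circ}{\mathcal{P}}_m$ is the set of polynomials $f$ on $\mathbb{R}^{n+1}$ of degree at most $m$ with $\int_{\mathbb{S}^n}f\,d\mu=0$. $\mathcal{M}_m^c(\mathbb{S}^n)$ is the set of probability measures $\nu$ on $\mathbb{S}^n$ supported on countably many (finitely or countably infinitely many) points such that $\int_{\mathbb{S}^n}f\,d\nu=0$ for all $f\in\overset{\circ}{\mathcal{P}}_m$. For $0<\theta<1$, $$\Theta(m,\theta,n)=\inf\left\{\sum_i\nu_i^{\theta}:\nu\in\mathcal{M}_m^c(\mathbb{S}^n)\text{ is supported on the distinct points }\{\xi_i\}\subset\mathbb{S}^n,\ \nu_i=\nu(\{\xi_i\})\right\}.$$ "Achieved at $\nu$" means that $\nu$ attains this infimum. $\delta_\xi$ is the Dirac measure at $\xi$. *)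

theory Defs
  imports "HOL-Probability.Probability"
begin

text \<open>The dimension is carried by the type: \<open>\<real>\<^sup>n\<^sup>+\<^sup>1\<close> is a Euclidean space \<open>'a\<close> with \<open>DIM('a) = n + 1\<close>,
  and the sphere is \<open>sphere 0 1 :: 'a set\<close>.\<close>

definition sphere_borel :: "'a::euclidean_space measure" where
  "sphere_borel = restrict_space borel (sphere 0 1)"

text \<open>The standard (surface) measure, given in polar coordinates: the measure of \<open>A\<close> is \<open>n + 1\<close> times
  the Lebesgue measure of the cone \<open>{r x | 0 < r < 1, x \<in> A}\<close>; note \<open>sgn x = x / norm x\<close>.\<close>

definition sphere_measure :: "'a::euclidean_space measure" where
  "sphere_measure =
     scale_measure (of_nat DIM('a))
       (distr (restrict_space lborel (ball 0 1 - {0})) sphere_borel sgn)"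

lemma emeasure_sphere_measure:
  fixes A :: "'a::euclidean_space set"
  assumes A: "A \<in> sets sphere_borel"
  shows "emeasure sphere_measure A =
           of_nat DIM('a) * emeasure lborel {r *\<^sub>R x | r x. 0 < r \<and> r < 1 \<and> x \<in> A}"
proof -
  have AS: "A \<subseteq> sphere 0 1"
    using A by (auto simp: sphere_borel_def sets_restrict_space)
  have "sgn \<in> restrict_space borel (ball 0 1 - {0::'a}) \<rightarrow>\<^sub>M borel"
    by (intro borel_measurable_continuous_on_restrict continuous_intros) auto
  then have meas: "sgn \<in> restrict_space lborel (ball 0 1 - {0::'a}) \<rightarrow>\<^sub>M sphere_borel"
    unfolding sphere_borel_def
    by (intro measurable_restrict_space2)
       (auto simp: space_restrict_space norm_sgn cong: measurable_cong_sets sets_restrict_space_cong)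
  have cone: "sgn -` A \<inter> (ball 0 1 - {0}) = {r *\<^sub>R x | r x. 0 < r \<and> r < 1 \<and> x \<in> A}"
  proof (intro set_eqI iffI)
    fix y assume "y \<in> sgn -` A \<inter> (ball 0 1 - {0})"
    then show "y \<in> {r *\<^sub>R x | r x. 0 < r \<and> r < 1 \<and> x \<in> A}"
      by (auto intro!: exI[of _ "norm y"] exI[of _ "sgn y"] simp: sgn_div_norm)
  next
    fix y assume "y \<in> {r *\<^sub>R x | r x. 0 < r \<and> r < 1 \<and> x \<in> A}"
    with AS show "y \<in> sgn -` A \<inter> (ball 0 1 - {0})"
      by (auto simp: sgn_div_norm subset_iff)
  qed
  have "emeasure (restrict_space lborel (ball 0 1 - {0})) {r *\<^sub>R x | r x. 0 < r \<and> r < 1 \<and> x \<in> A} =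
        emeasure lborel {r *\<^sub>R x | r x. 0 < r \<and> r < 1 \<and> x \<in> A}"
    by (rule emeasure_restrict_space) (auto simp flip: cone)
  then show ?thesis
    unfolding sphere_measure_def
    using A by (simp add: emeasure_distr[OF meas] space_restrict_space cone)
qed

definition polys_deg_le :: "nat \<Rightarrow> ('a::euclidean_space \<Rightarrow> real) set" where
  "polys_deg_le m =
     {f. \<exists>(J :: ('a \<Rightarrow> nat) set) c. finite J \<and> (\<forall>\<alpha>\<in>J. (\<Sum>b\<in>Basis. \<alpha> b) \<le> m) \<and>
           f = (\<lambda>x. \<Sum>\<alpha>\<in>J. c \<alpha> * (\<Prod>b\<in>Basis. (x \<bullet> b) ^ \<alpha> b))}"

definition mean_zero_polys :: "nat \<Rightarrow> ('a::euclidean_space \<Rightarrow> real) set" where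
  "mean_zero_polys m = {f \<in> polys_deg_le m. (\<integral>x. f x \<partial>sphere_measure) = 0}"

definition countable_designs :: "nat \<Rightarrow> 'a::euclidean_space measure set" where
  "countable_designs m =
     {\<nu>. prob_space \<nu> \<and> sets \<nu> = sets sphere_borel \<and>
         (\<exists>C. countable C \<and> C \<subseteq> sphere 0 1 \<and> emeasure \<nu> C = 1) \<and>
         (\<forall>f\<in>mean_zero_polys m. (\<integral>x. f x \<partial>\<nu>) = 0)}"

text \<open>The points \<open>\<xi>\<^sub>i\<close> on which \<open>\<nu>\<close> is supported are its atoms (not its topological support, which may be
  larger when there are infinitely many). The sum may diverge, so it is taken in \<open>ennreal\<close>.\<close>

definition atoms :: "'a::euclidean_space measure \<Rightarrow> 'a set" where
  "atoms \<nu> = {x \<in> sphere 0 1. measure \<nu> {x} > 0}"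

definition power_sum :: "real \<Rightarrow> 'a::euclidean_space measure \<Rightarrow> ennreal" where
  "power_sum \<theta> \<nu> = (\<Sum>\<^sub>\<infinity>x\<in>atoms \<nu>. ennreal (measure \<nu> {x} powr \<theta>))"

definition Theta :: "'a::euclidean_space itself \<Rightarrow> nat \<Rightarrow> real \<Rightarrow> ennreal" where
  "Theta _ m \<theta> = (INF \<nu>\<in>(countable_designs m :: 'a measure set). power_sum \<theta> \<nu>)"

definition Theta_achieved_at :: "nat \<Rightarrow> real \<Rightarrow> 'a::euclidean_space measure \<Rightarrow> bool" where
  "Theta_achieved_at m \<theta> \<nu> \<longleftrightarrow>
     \<nu> \<in> countable_designs m \<and> power_sum \<theta> \<nu> = Theta TYPE('a) m \<theta>"

text \<open>Affine independence and the vertex count say that the convex hull of \<open>V\<close> is a \<open>k simplex\<close> with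
  vertex set \<open>V\<close>; regularity means that all edges have the same length.\<close>

definition regular_simplex_vertices :: "nat \<Rightarrow> 'a::euclidean_space set \<Rightarrow> bool" where
  "regular_simplex_vertices k V \<longleftrightarrow>
     \<not> affine_dependent V \<and> card V = k + 1 \<and> (\<exists>d. pairwise (\<lambda>x y. dist x y = d) V)"

text \<open>\<open>\<nu> = (1/|I|) \<Sum>\<^sub>i\<^sub>\<in>\<^sub>I \<delta>\<^bsub>\<xi> i\<^esub>\<close> as Borel measures on the sphere; \<open>return\<close> is the Dirac measure.\<close>

definition is_dirac_average ::
  "'i set \<Rightarrow> ('i \<Rightarrow> 'a::euclidean_space) \<Rightarrow> 'a measure \<Rightarrow> bool" where
  "is_dirac_average I \<xi> \<nu> \<longleftrightarrow>
     sets \<nu> = sets sphere_borel \<and>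
     (\<forall>A\<in>sets sphere_borel.
        emeasure \<nu> A = ennreal (1 / real (card I)) * (\<Sum>i\<in>I. emeasure (return sphere_borel (\<xi> i)) A))"

end

theory Submission
  imports Defs "HOL-Combinatorics.Transposition"
begin

text \<open>
  Write \<open>d = n + 1\<close> for the dimension of the ambient space and \<open>N = d + 1 = n + 2\<close>.

  A probability measure \<open>\<nu>\<close> on the sphere annihilates all mean-zero polynomials of degree at most
  two iff it has barycentre \<open>0\<close> and second moments \<open>\<integral> x\<^sub>b x\<^sub>c d\<nu> = \<delta>\<^sub>b\<^sub>c / d\<close>
  (\<open>annihilates_mean_zero_polys_2_iff_isotropic\<close>). The surface measure has the same moments up to
  its total mass, by invariance under sign changes and exchanges of coordinates, so that no
  integral over the sphere has to be computed.

  For such a \<open>\<nu>\<close> and a unit vector \<open>x\<close>, the polynomial \<open>(1 + d (x \<bullet> y))\<^sup>2\<close> in \<open>y\<close> is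
  nonnegative, has \<open>\<nu>\<close>-integral \<open>1 + d\<close> and takes the value \<open>(1 + d)\<^sup>2\<close> at \<open>y = x\<close>. Hence every
  atom has mass at most \<open>1 / N\<close> (\<open>isotropic_atom_le\<close>), and if the mass of \<open>x\<close> equals \<open>1 / N\<close> then
  the polynomial vanishes at every other atom \<open>y\<close>, that is, \<open>x \<bullet> y = - 1 / d\<close>
  (\<open>isotropic_atoms_inner\<close>). As \<open>t\<^sup>\<theta> \<ge> N\<^bsup>1 - \<theta>\<^esup> t\<close> for \<open>0 < t \<le> 1 / N\<close>, with equality only at
  \<open>t = 1 / N\<close>, summing over the atoms gives the lower bound \<open>N\<^bsup>1 - \<theta>\<^esup>\<close>, and equality forces all atoms
  to have mass \<open>1 / N\<close> (\<open>power_sum_lower_bound\<close>). Then there are \<open>N\<close> atoms with pairwise inner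
  products \<open>- 1 / d\<close>, and these are the vertices of a regular simplex.

  Conversely, the vertices \<open>v\<close> of a regular \<open>d\<close>-simplex inscribed in the sphere satisfy \<open>\<Sum> v = 0\<close>
  and \<open>\<Sum> (v \<bullet> x) v = (1 + 1/d) x\<close> (\<open>regular_simplex_vertices_tight_frame\<close>), so that their uniform
  average has the required moments. A coordinate construction shows that such simplices exist.
\<close>

section \<open>Measures on the sphere\<close>

lemma space_sphere_borel: "space (sphere_borel :: 'a::euclidean_space measure) = sphere 0 1"
  by (simp add: sphere_borel_def space_restrict_space)

lemma sets_sphere_borel_iff:
  "A \<in> sets sphere_borel \<longleftrightarrow> A \<in> sets borel \<and> A \<subseteq> sphere (0::'a::euclidean_space) 1"
  by (auto simp: sphere_borel_def sets_restrict_space_iff)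

lemma countable_in_sphere_borel:
  assumes "countable A" "A \<subseteq> sphere (0::'a::euclidean_space) 1"
  shows "A \<in> sets sphere_borel"
proof -
  have "A \<in> sets borel" using assms(1) by (rule sets.countable[rotated]) simp
  with assms show ?thesis by (auto simp: sets_sphere_borel_iff)
qed

lemma integrable_continuous_on_sphere:
  fixes f :: "'a::euclidean_space \<Rightarrow> real"
  assumes "finite_measure M" and sets: "sets M = sets sphere_borel"
    and cont: "continuous_on (sphere 0 1) f"
  shows "integrable M f"
proof -
  interpret finite_measure M by fact
  have "f \<in> borel_measurable (restrict_space borel (sphere 0 1))"
    using cont by (intro borel_measurable_continuous_on_restrict)
  then have meas: "f \<in> borel_measurable M"
    using sets by (simp add: sphere_borel_def cong: measurable_cong_sets)
  have "bounded (f ` sphere 0 1)"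
    using cont by (intro compact_imp_bounded compact_continuous_image) auto
  then obtain B where "\<forall>x\<in>sphere 0 1. norm (f x) \<le> B"
    by (auto simp: bounded_iff)
  moreover have "space M = sphere 0 1"
    using sets_eq_imp_space_eq[OF sets] by (simp add: space_sphere_borel)
  ultimately show ?thesis
    using meas by (intro integrable_const_bound[where B = B]) auto
qed

lemma sets_sphere_measure: "sets sphere_measure = sets sphere_borel"
  by (simp add: sphere_measure_def)

lemma space_sphere_measure: "space (sphere_measure :: 'a::euclidean_space measure) = sphere 0 1"
  using sets_eq_imp_space_eq[OF sets_sphere_measure] by (simp add: space_sphere_borel)

text \<open>The cone over a set of unit vectors is a preimage under \<open>sgn\<close>, which makes measurability and the
  action of isometries evident.\<close>

lemma cone_over_eq:
  fixes B :: "'a::euclidean_space set"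
  assumes "B \<subseteq> sphere 0 1"
  shows "{r *\<^sub>R x | r x. 0 < r \<and> r < 1 \<and> x \<in> B} = {y \<in> ball 0 1 - {0}. sgn y \<in> B}"
proof (intro set_eqI iffI)
  fix y assume "y \<in> {r *\<^sub>R x | r x. 0 < r \<and> r < 1 \<and> x \<in> B}"
  with assms show "y \<in> {y \<in> ball 0 1 - {0}. sgn y \<in> B}"
    by (auto simp: sgn_div_norm subset_iff)
next
  fix y assume "y \<in> {y \<in> ball 0 1 - {0}. sgn y \<in> B}"
  then show "y \<in> {r *\<^sub>R x | r x. 0 < r \<and> r < 1 \<and> x \<in> B}"
    by (auto intro!: exI[of _ "norm y"] exI[of _ "sgn y"] simp: sgn_div_norm)
qed

lemma emeasure_sphere_measure_space:
  "emeasure sphere_measure (sphere (0::'a::euclidean_space) 1) =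
     of_nat DIM('a) * emeasure lborel (ball (0::'a) 1 - {0})"
proof -
  have "{r *\<^sub>R x | r x. 0 < r \<and> r < 1 \<and> x \<in> sphere 0 1} = ball (0::'a) 1 - {0}"
    by (subst cone_over_eq) (auto simp: norm_sgn)
  then show ?thesis
    using emeasure_sphere_measure[of "sphere (0::'a) 1"] by (simp add: sets_sphere_borel_iff)
qed

lemma finite_measure_sphere_measure: "finite_measure (sphere_measure :: 'a::euclidean_space measure)"
proof
  have "emeasure lborel (ball (0::'a) 1 - {0}) \<le> emeasure lborel (ball (0::'a) 1)"
    by (intro emeasure_mono) auto
  also have "\<dots> < \<infinity>" by (rule emeasure_lborel_ball_finite)
  finally show "emeasure (sphere_measure :: 'a measure) (space sphere_measure) \<noteq> \<infinity>"
    by (auto simp: space_sphere_measure emeasure_sphere_measure_space ennreal_mult_eq_top_iff)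
qed

lemma measure_sphere_measure_pos:
  "measure (sphere_measure :: 'a::euclidean_space measure) (space sphere_measure) > 0"
proof -
  interpret finite_measure "sphere_measure :: 'a measure" by (rule finite_measure_sphere_measure)
  have "emeasure lborel (ball (0::'a) 1 - {0}) = emeasure lborel (ball (0::'a) 1)"
    by (intro emeasure_Diff_null_set) auto
  moreover have "emeasure lborel (ball (0::'a) 1) \<noteq> 0"
    using content_ball_pos[of 1 "0::'a"] by (auto simp: measure_def)
  ultimately have "emeasure (sphere_measure :: 'a measure) (space sphere_measure) \<noteq> 0"
    by (simp add: space_sphere_measure emeasure_sphere_measure_space)
  then show ?thesis by (simp add: emeasure_eq_measure zero_less_measure_iff)
qed

lemma borel_measurable_linear:
  fixes T :: "'a::euclidean_space \<Rightarrow> 'b::euclidean_space"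
  assumes "linear T"
  shows "T \<in> borel_measurable borel"
  using assms
  by (intro borel_measurable_continuous_onI linear_continuous_on)
     (simp add: linear_conv_bounded_linear)

lemma measurable_linear_isometry_sphere:
  fixes T :: "'a::euclidean_space \<Rightarrow> 'a"
  assumes "linear T" and "\<And>x. norm (T x) = norm x"
  shows "T \<in> sphere_borel \<rightarrow>\<^sub>M sphere_borel"
  unfolding sphere_borel_def
  by (intro measurable_restrict_space3 borel_measurable_linear assms) (auto simp: assms)

text \<open>The surface measure of \<open>A\<close> is a multiple of the Lebesgue measure of the cone over \<open>A\<close>, and linear
  isometries map cones to cones.\<close>

lemma distr_sphere_measure_isometry:
  fixes T :: "'a::euclidean_space \<Rightarrow> 'a"
  assumes lin: "linear T" and iso: "\<And>x. norm (T x) = norm x"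
    and inv: "distr lborel borel T = lborel"
  shows "distr sphere_measure sphere_borel T = sphere_measure"
proof (rule measure_eqI)
  show "sets (distr sphere_measure sphere_borel T) = sets sphere_measure"
    by (simp add: sets_sphere_measure)
next
  fix A assume "A \<in> sets (distr sphere_measure sphere_borel T)"
  then have A: "A \<in> sets sphere_borel" by simp
  have [measurable]: "T \<in> borel_measurable borel"
    using lin by (rule borel_measurable_linear)
  have T_sphere: "T \<in> sphere_borel \<rightarrow>\<^sub>M sphere_borel"
    using lin iso by (rule measurable_linear_isometry_sphere)
  have T_sm: "T \<in> sphere_measure \<rightarrow>\<^sub>M sphere_borel"
    using T_sphere by (simp only: measurable_cong_sets[OF sets_sphere_measure refl])
  have pre: "T -` A \<inter> sphere 0 1 \<in> sets sphere_borel"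
    using measurable_sets[OF T_sphere A] by (simp add: space_sphere_borel)
  let ?cone = "\<lambda>A. {r *\<^sub>R x | r x. 0 < r \<and> r < 1 \<and> x \<in> A} :: 'a set"
  have AS: "A \<in> sets borel" "A \<subseteq> sphere 0 1"
    using A by (auto simp: sets_sphere_borel_iff)
  have sgn_T: "sgn (T x) = T (sgn x)" for x
    using lin by (simp add: sgn_div_norm iso linear_cmul)
  have T0: "T x = 0 \<longleftrightarrow> x = 0" for x
    using iso[of x] by (metis norm_eq_zero)
  have [measurable]: "?cone A \<in> sets borel"
    unfolding cone_over_eq[OF AS(2)] using AS(1) by measurable
  have "emeasure (distr sphere_measure sphere_borel T) A =
        emeasure sphere_measure (T -` A \<inter> sphere 0 1)"
    using A by (simp add: emeasure_distr[OF T_sm] space_sphere_measure)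
  also have "\<dots> = of_nat DIM('a) * emeasure lborel (?cone (T -` A \<inter> sphere 0 1))"
    by (rule emeasure_sphere_measure[OF pre])
  also have "?cone (T -` A \<inter> sphere 0 1) = T -` ?cone A"
    by (subst (1 2) cone_over_eq) (use AS in \<open>auto simp: sgn_T iso T0 norm_sgn\<close>)
  also have "emeasure lborel (T -` ?cone A) = emeasure (distr lborel borel T) (?cone A)"
    by (subst emeasure_distr) auto
  also have "of_nat DIM('a) * \<dots> = emeasure sphere_measure A"
    unfolding inv by (rule emeasure_sphere_measure[OF A, symmetric])
  finally show "emeasure (distr sphere_measure sphere_borel T) A = emeasure sphere_measure A" .
qed

lemma integral_sphere_measure_isometry:
  fixes T :: "'a::euclidean_space \<Rightarrow> 'a" and f :: "'a \<Rightarrow> real"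
  assumes lin: "linear T" and iso: "\<And>x. norm (T x) = norm x"
    and inv: "distr lborel borel T = lborel"
    and cont: "continuous_on (sphere 0 1) f"
  shows "(\<integral>x. f (T x) \<partial>sphere_measure) = (\<integral>x. f x \<partial>sphere_measure)"
proof -
  have T: "T \<in> sphere_measure \<rightarrow>\<^sub>M sphere_borel"
    using measurable_linear_isometry_sphere[OF lin iso]
    by (simp only: measurable_cong_sets[OF sets_sphere_measure refl])
  have f: "f \<in> borel_measurable sphere_borel"
    unfolding sphere_borel_def by (rule borel_measurable_continuous_on_restrict[OF cont])
  show ?thesis
    using integral_distr[OF T f] distr_sphere_measure_isometry[OF lin iso inv] by simp
qed

section \<open>Reflections and Lebesgue measure\<close>

text \<open>The reflection in the hyperplane orthogonal to \<open>c\<close>; for \<open>c = 0\<close>, since division by zero gives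
  zero, it is the identity. For basis vectors \<open>b \<noteq> c\<close>, \<open>reflect c\<close> changes the sign of the coordinate
  \<open>c\<close>, and \<open>reflect (b - c)\<close> exchanges the coordinates \<open>b\<close> and \<open>c\<close>.\<close>

definition reflect :: "'a::euclidean_space \<Rightarrow> 'a \<Rightarrow> 'a" where
  "reflect c x = x - (2 * (x \<bullet> c) / (c \<bullet> c)) *\<^sub>R c"

lemma linear_reflect: "linear (reflect c)"
  by (intro linearI) (auto simp: reflect_def inner_simps algebra_simps add_divide_distrib)

lemma norm_reflect: "norm (reflect c x) = norm x"
proof (cases "c = 0")
  case False
  then have "reflect c x \<bullet> reflect c x = x \<bullet> x"
    by (simp add: reflect_def inner_simps inner_commute field_simps)
  then show ?thesis by (simp add: norm_eq_sqrt_inner)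
qed (simp add: reflect_def)

lemma reflect_Basis:
  assumes "c \<in> Basis" "i \<in> Basis"
  shows "reflect c x \<bullet> i = (if i = c then - (x \<bullet> i) else x \<bullet> i)"
  using assms by (auto simp: reflect_def inner_simps inner_Basis)

lemma reflect_swap:
  assumes "b \<in> Basis" "c \<in> Basis" "i \<in> Basis" "b \<noteq> c"
  shows "reflect (b - c) x \<bullet> i = x \<bullet> Transposition.transpose b c i"
  using assms by (auto simp: reflect_def inner_simps inner_Basis Transposition.transpose_def field_simps)

lemma lborel_reflect_Basis:
  assumes c: "c \<in> (Basis :: 'a::euclidean_space set)"
  shows "distr lborel borel (reflect c) = lborel"
proof (rule lborel_eqI[symmetric])
  have T[measurable]: "reflect c \<in> borel_measurable borel"
    by (rule borel_measurable_linear[OF linear_reflect])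
  fix l u :: 'a assume lu: "\<And>b. b \<in> Basis \<Longrightarrow> l \<bullet> b \<le> u \<bullet> b"
  define l' where "l' = (\<Sum>i\<in>Basis. (if i = c then - (u \<bullet> i) else l \<bullet> i) *\<^sub>R i)"
  define u' where "u' = (\<Sum>i\<in>Basis. (if i = c then - (l \<bullet> i) else u \<bullet> i) *\<^sub>R i)"
  have l': "l' \<bullet> i = (if i = c then - (u \<bullet> i) else l \<bullet> i)"
    and u': "u' \<bullet> i = (if i = c then - (l \<bullet> i) else u \<bullet> i)" if "i \<in> Basis" for i
    using that by (simp_all add: l'_def u'_def)
  have "reflect c -` box l u = box l' u'"
  proof (intro set_eqI)
    fix x
    have "(l \<bullet> i < reflect c x \<bullet> i \<and> reflect c x \<bullet> i < u \<bullet> i) \<longleftrightarrow>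
          (l' \<bullet> i < x \<bullet> i \<and> x \<bullet> i < u' \<bullet> i)" if "i \<in> Basis" for i
      using c that by (auto simp: reflect_Basis l' u')
    then show "x \<in> reflect c -` box l u \<longleftrightarrow> x \<in> box l' u'"
      by (simp add: mem_box)
  qed
  then have "emeasure (distr lborel borel (reflect c)) (box l u) = emeasure lborel (box l' u')"
    by (simp add: emeasure_distr)
  also have "\<dots> = (\<Prod>b\<in>Basis. (u' - l') \<bullet> b)"
    by (rule emeasure_lborel_box) (auto simp: l' u' lu)
  also have "(\<Prod>b\<in>Basis. (u' - l') \<bullet> b) = (\<Prod>b\<in>Basis. (u - l) \<bullet> b)"
    by (intro prod.cong) (auto simp: inner_diff_left l' u')
  finally show "emeasure (distr lborel borel (reflect c)) (box l u) = (\<Prod>b\<in>Basis. (u - l) \<bullet> b)" .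
qed simp

lemma lborel_reflect_swap:
  assumes b: "b \<in> (Basis :: 'a::euclidean_space set)" and c: "c \<in> Basis" and "b \<noteq> c"
  shows "distr lborel borel (reflect (b - c)) = lborel"
proof (rule lborel_eqI[symmetric])
  let ?T = "reflect (b - c)"
  note swap = reflect_swap[OF b c _ \<open>b \<noteq> c\<close>]
  have T[measurable]: "?T \<in> borel_measurable borel"
    by (rule borel_measurable_linear[OF linear_reflect])
  have tB: "Transposition.transpose b c i \<in> Basis" if "i \<in> Basis" for i
    using that b c by (auto simp: Transposition.transpose_def)
  fix l u :: 'a assume lu: "\<And>b. b \<in> Basis \<Longrightarrow> l \<bullet> b \<le> u \<bullet> b"
  have "?T -` box l u = box (?T l) (?T u)"
  proof (intro set_eqI)
    fix x
    have "(\<forall>i\<in>Basis. P (x \<bullet> Transposition.transpose b c i) i) \<longleftrightarrow> (\<forall>i\<in>Basis. P (x \<bullet> i) (Transposition.transpose b c i))"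
      for P :: "real \<Rightarrow> 'a \<Rightarrow> bool"
      using tB by (metis transpose_involutory)
    from this[of "\<lambda>r i. l \<bullet> i < r \<and> r < u \<bullet> i"]
    show "x \<in> ?T -` box l u \<longleftrightarrow> x \<in> box (?T l) (?T u)"
      by (simp add: mem_box swap)
  qed
  then have "emeasure (distr lborel borel ?T) (box l u) = emeasure lborel (box (?T l) (?T u))"
    by (simp add: emeasure_distr)
  also have "\<dots> = (\<Prod>i\<in>Basis. (?T u - ?T l) \<bullet> i)"
    by (rule emeasure_lborel_box) (simp add: swap lu tB)
  also have "(\<Prod>i\<in>Basis. (?T u - ?T l) \<bullet> i) = (\<Prod>i\<in>Basis. (u - l) \<bullet> Transposition.transpose b c i)"
    by (intro prod.cong) (auto simp: inner_diff_left swap)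
  also have "\<dots> = (\<Prod>i\<in>Basis. (u - l) \<bullet> i)"
    by (rule prod.reindex_bij_witness[of _ "Transposition.transpose b c" "Transposition.transpose b c"]) (auto simp: tB)
  finally show "emeasure (distr lborel borel ?T) (box l u) = (\<Prod>b\<in>Basis. (u - l) \<bullet> b)" .
qed simp

section \<open>Isotropic measures\<close>

text \<open>A measure is isotropic if its first moments vanish and its matrix of second moments is a multiple
  of the identity. The multiple is normalised for measures on the unit sphere, where the trace
  \<open>\<integral> (norm x)\<^sup>2 dM\<close> is the total mass. The definition does not require the measure to be a
  probability measure, so that it applies to the surface measure as well.\<close>

definition isotropic :: "'a::euclidean_space measure \<Rightarrow> bool" where
  "isotropic M \<longleftrightarrow> (\<forall>b\<in>Basis. (\<integral>x. x \<bullet> b \<partial>M) = 0) \<and>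
     (\<forall>b\<in>Basis. \<forall>c\<in>Basis. (\<integral>x. (x \<bullet> b) * (x \<bullet> c) \<partial>M) =
        (if b = c then measure M (space M) / DIM('a) else 0))"

text \<open>On the sphere it is enough that the diagonal second moments agree with each other, because their sum
  is the total mass.\<close>

lemma isotropicI:
  fixes M :: "'a::euclidean_space measure"
  assumes fin: "finite_measure M" and sets: "sets M = sets sphere_borel"
    and lin: "\<And>b. b \<in> Basis \<Longrightarrow> (\<integral>x. x \<bullet> b \<partial>M) = 0"
    and off: "\<And>b c. b \<in> Basis \<Longrightarrow> c \<in> Basis \<Longrightarrow> b \<noteq> c \<Longrightarrow> (\<integral>x. (x \<bullet> b) * (x \<bullet> c) \<partial>M) = 0"
    and diag: "\<And>b c. b \<in> Basis \<Longrightarrow> c \<in> Basis \<Longrightarrow> (\<integral>x. (x \<bullet> b)^2 \<partial>M) = (\<integral>x. (x \<bullet> c)^2 \<partial>M)"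
  shows "isotropic M"
proof -
  have space: "space M = sphere 0 1"
    using sets_eq_imp_space_eq[OF sets] by (simp add: space_sphere_borel)
  have int: "integrable M (\<lambda>x. (x \<bullet> b)^2)" for b
    by (intro integrable_continuous_on_sphere fin sets continuous_intros)
  have "(\<integral>x. (x \<bullet> b)^2 \<partial>M) = measure M (space M) / DIM('a)" if b: "b \<in> Basis" for b
  proof -
    have "measure M (space M) = (\<integral>x. 1 \<partial>M)" by simp
    also have "\<dots> = (\<integral>x. (\<Sum>c\<in>Basis. (x \<bullet> c)^2) \<partial>M)"
    proof (rule Bochner_Integration.integral_cong)
      fix x :: 'a assume "x \<in> space M"
      then have "x \<bullet> x = 1" by (simp add: space norm_eq_sqrt_inner)
      then show "1 = (\<Sum>c\<in>Basis. (x \<bullet> c)^2)"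
        by (simp add: euclidean_inner[of x x] power2_eq_square)
    qed simp
    also have "\<dots> = (\<Sum>c\<in>Basis. (\<integral>x. (x \<bullet> c)^2 \<partial>M))"
      by (rule Bochner_Integration.integral_sum) (rule int)
    also have "\<dots> = (\<Sum>c\<in>(Basis :: 'a set). (\<integral>x. (x \<bullet> b)^2 \<partial>M))"
      by (intro sum.cong refl diag[OF _ b])
    finally show ?thesis by (simp add: field_simps)
  qed
  with lin off show ?thesis by (auto simp: isotropic_def power2_eq_square)
qed

lemma isotropic_sphere_measure: "isotropic (sphere_measure :: 'a::euclidean_space measure)"
proof (rule isotropicI[OF finite_measure_sphere_measure sets_sphere_measure])
  note inv = integral_sphere_measure_isometry[OF linear_reflect norm_reflect]
  fix b :: 'a assume b: "b \<in> Basis"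
  have "(\<integral>x. reflect b x \<bullet> b \<partial>sphere_measure) = (\<integral>x. x \<bullet> b \<partial>sphere_measure)"
    by (rule inv[OF lborel_reflect_Basis[OF b]]) (intro continuous_intros)
  then show "(\<integral>x. x \<bullet> b \<partial>sphere_measure) = 0"
    using b by (simp add: reflect_Basis)
next
  note inv = integral_sphere_measure_isometry[OF linear_reflect norm_reflect]
  fix b c :: 'a assume b: "b \<in> Basis" and c: "c \<in> Basis" and "b \<noteq> c"
  have "(\<integral>x. (reflect b x \<bullet> b) * (reflect b x \<bullet> c) \<partial>sphere_measure) =
        (\<integral>x. (x \<bullet> b) * (x \<bullet> c) \<partial>sphere_measure)"
    by (rule inv[OF lborel_reflect_Basis[OF b]]) (intro continuous_intros)
  then show "(\<integral>x. (x \<bullet> b) * (x \<bullet> c) \<partial>sphere_measure) = 0"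
    using b c \<open>b \<noteq> c\<close> by (simp add: reflect_Basis)
next
  note inv = integral_sphere_measure_isometry[OF linear_reflect norm_reflect]
  fix b c :: 'a assume b: "b \<in> Basis" and c: "c \<in> Basis"
  show "(\<integral>x. (x \<bullet> b)^2 \<partial>sphere_measure) = (\<integral>x. (x \<bullet> c)^2 \<partial>sphere_measure)"
  proof (cases "b = c")
    case False
    have "(\<integral>x. (reflect (b - c) x \<bullet> c)^2 \<partial>sphere_measure) = (\<integral>x. (x \<bullet> c)^2 \<partial>sphere_measure)"
      by (rule inv[OF lborel_reflect_swap[OF b c False]]) (intro continuous_intros)
    then show ?thesis
      using b c False by (simp add: reflect_swap)
  qed simp
qed

section \<open>Polynomials of degree at most two\<close>

lemma monomial_Suc:
  fixes \<alpha> :: "'a::euclidean_space \<Rightarrow> nat"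
  assumes "(\<Sum>b\<in>Basis. \<alpha> b) = Suc k"
  obtains b \<beta> where "b \<in> Basis" "(\<Sum>b\<in>Basis. \<beta> b) = k"
    "\<And>x::'a. (\<Prod>i\<in>Basis. (x \<bullet> i) ^ \<alpha> i) = (x \<bullet> b) * (\<Prod>i\<in>Basis. (x \<bullet> i) ^ \<beta> i)"
proof -
  from assms obtain b where b: "b \<in> Basis" and "\<alpha> b \<noteq> 0"
    by (metis Zero_not_Suc sum.neutral)
  then obtain j where j: "\<alpha> b = Suc j" by (cases "\<alpha> b") auto
  define \<beta> where "\<beta> = \<alpha>(b := j)"
  have "(\<Sum>i\<in>Basis - {b}. \<beta> i) = (\<Sum>i\<in>Basis - {b}. \<alpha> i)"
    by (intro sum.cong) (auto simp: \<beta>_def)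
  then have "(\<Sum>i\<in>Basis. \<beta> i) = k"
    using assms j b by (simp add: sum.remove[of Basis b] \<beta>_def)
  moreover have "(\<Prod>i\<in>Basis. (x \<bullet> i) ^ \<alpha> i) = (x \<bullet> b) * (\<Prod>i\<in>Basis. (x \<bullet> i) ^ \<beta> i)" for x :: 'a
  proof -
    have "(\<Prod>i\<in>Basis - {b}. (x \<bullet> i) ^ \<beta> i) = (\<Prod>i\<in>Basis - {b}. (x \<bullet> i) ^ \<alpha> i)"
      by (intro prod.cong) (auto simp: \<beta>_def)
    then show ?thesis
      using j b by (simp add: prod.remove[of Basis b] \<beta>_def mult.assoc)
  qed
  ultimately show ?thesis using b that by blast
qed

lemma monomial_deg_le_2_cases:
  fixes \<alpha> :: "'a::euclidean_space \<Rightarrow> nat"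
  assumes "(\<Sum>b\<in>Basis. \<alpha> b) \<le> 2"
  obtains (const) "\<And>x::'a. (\<Prod>i\<in>Basis. (x \<bullet> i) ^ \<alpha> i) = 1"
    | (linear) b where "b \<in> Basis" "\<And>x::'a. (\<Prod>i\<in>Basis. (x \<bullet> i) ^ \<alpha> i) = x \<bullet> b"
    | (quadratic) b c where "b \<in> Basis" "c \<in> Basis"
        "\<And>x::'a. (\<Prod>i\<in>Basis. (x \<bullet> i) ^ \<alpha> i) = (x \<bullet> b) * (x \<bullet> c)"
proof -
  have zero: "(\<Prod>i\<in>Basis. (x \<bullet> i) ^ \<beta> i) = 1"
    if "(\<Sum>b\<in>Basis. \<beta> b) = 0" for \<beta> :: "'a \<Rightarrow> nat" and x
    using that by (intro prod.neutral) auto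
  consider "(\<Sum>b\<in>Basis. \<alpha> b) = 0" | "(\<Sum>b\<in>Basis. \<alpha> b) = Suc 0" | "(\<Sum>b\<in>Basis. \<alpha> b) = Suc (Suc 0)"
    using assms by linarith
  then show ?thesis
  proof cases
    case 1
    then show ?thesis using zero const by blast
  next
    case 2
    then show ?thesis
      by (rule monomial_Suc) (use zero linear in auto)
  next
    case 3
    then obtain b \<beta> where b: "b \<in> Basis" and \<beta>: "(\<Sum>b\<in>Basis. \<beta> b) = Suc 0"
      and eq: "\<And>x::'a. (\<Prod>i\<in>Basis. (x \<bullet> i) ^ \<alpha> i) = (x \<bullet> b) * (\<Prod>i\<in>Basis. (x \<bullet> i) ^ \<beta> i)"
      using monomial_Suc by blast
    from \<beta> obtain c \<gamma> where c: "c \<in> Basis" and \<gamma>: "(\<Sum>b\<in>Basis. \<gamma> b) = 0"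
      and eq': "\<And>x::'a. (\<Prod>i\<in>Basis. (x \<bullet> i) ^ \<beta> i) = (x \<bullet> c) * (\<Prod>i\<in>Basis. (x \<bullet> i) ^ \<gamma> i)"
      using monomial_Suc by blast
    show ?thesis
      using b c zero[OF \<gamma>] by (intro quadratic[of b c]) (simp_all add: eq eq')
  qed
qed

lemma polys_deg_le_monomial:
  fixes \<alpha> :: "'a::euclidean_space \<Rightarrow> nat"
  assumes "(\<Sum>b\<in>Basis. \<alpha> b) \<le> m"
  shows "(\<lambda>x. \<Prod>i\<in>Basis. (x \<bullet> i) ^ \<alpha> i) \<in> polys_deg_le m"
  unfolding polys_deg_le_def using assms
  by (intro CollectI exI[of _ "{\<alpha>}"] exI[of _ "\<lambda>_. 1"]) auto

lemma prod_power_indicator: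
  assumes "b \<in> (Basis :: 'a::euclidean_space set)"
  shows "(\<Prod>i\<in>Basis. (x \<bullet> i) ^ (if i = b then k else 0)) = (x \<bullet> b) ^ k"
proof -
  have "(\<Prod>i\<in>Basis. (x \<bullet> i) ^ (if i = b then k else 0)) =
        (\<Prod>i\<in>Basis. if i = b then (x \<bullet> b) ^ k else 1)"
    by (intro prod.cong) auto
  then show ?thesis using assms by simp
qed

lemma inner_Basis_in_polys:
  assumes "b \<in> (Basis :: 'a::euclidean_space set)" "m \<ge> 1"
  shows "(\<lambda>x. x \<bullet> b) \<in> polys_deg_le m"
  using polys_deg_le_monomial[of "\<lambda>i. if i = b then 1 else 0" m] assms
  by (simp add: prod_power_indicator)

lemma inner_Basis_mult_in_polys:
  assumes "b \<in> (Basis :: 'a::euclidean_space set)" "c \<in> Basis" "m \<ge> 2"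
  shows "(\<lambda>x. (x \<bullet> b) * (x \<bullet> c)) \<in> polys_deg_le m"
  using polys_deg_le_monomial[of "\<lambda>i. (if i = b then 1 else 0) + (if i = c then 1 else 0)" m] assms
  by (simp add: power_add prod.distrib prod_power_indicator sum.distrib)

lemma polys_deg_le_diff:
  assumes "f \<in> polys_deg_le m" "g \<in> polys_deg_le m"
  shows "(\<lambda>x. f x - g x) \<in> polys_deg_le m"
proof -
  let ?M = "\<lambda>\<alpha> x. \<Prod>b\<in>Basis. (x \<bullet> b) ^ \<alpha> b"
  from assms obtain J c J' c' where J: "finite J" "\<forall>\<alpha>\<in>J. (\<Sum>b\<in>Basis. \<alpha> b) \<le> m"
      and f: "f = (\<lambda>x. \<Sum>\<alpha>\<in>J. c \<alpha> * ?M \<alpha> x)"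
      and J': "finite J'" "\<forall>\<alpha>\<in>J'. (\<Sum>b\<in>Basis. \<alpha> b) \<le> m"
      and g: "g = (\<lambda>x. \<Sum>\<alpha>\<in>J'. c' \<alpha> * ?M \<alpha> x)"
    by (auto simp: polys_deg_le_def)
  define e where "e \<alpha> = (if \<alpha> \<in> J then c \<alpha> else 0) - (if \<alpha> \<in> J' then c' \<alpha> else 0)" for \<alpha>
  have "f x - g x = (\<Sum>\<alpha>\<in>J \<union> J'. e \<alpha> * ?M \<alpha> x)" for x
  proof -
    have "f x = (\<Sum>\<alpha>\<in>J \<union> J'. (if \<alpha> \<in> J then c \<alpha> else 0) * ?M \<alpha> x)"
      unfolding f using J(1) J'(1) by (intro sum.mono_neutral_cong_left) auto
    moreover have "g x = (\<Sum>\<alpha>\<in>J \<union> J'. (if \<alpha> \<in> J' then c' \<alpha> else 0) * ?M \<alpha> x)"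
      unfolding g using J(1) J'(1) by (intro sum.mono_neutral_cong_left) auto
    ultimately show ?thesis
      by (simp add: e_def left_diff_distrib sum_subtractf)
  qed
  then show ?thesis
    unfolding polys_deg_le_def using J J'
    by (intro CollectI exI[of _ "J \<union> J'"] exI[of _ e]) auto
qed

lemma isotropic_integral_monomial:
  fixes M :: "'a::euclidean_space measure"
  assumes "isotropic M" "isotropic N" and \<alpha>: "(\<Sum>b\<in>Basis. \<alpha> b) \<le> 2"
  shows "measure N (space N) * (\<integral>x. (\<Prod>b\<in>Basis. (x \<bullet> b) ^ \<alpha> b) \<partial>M) =
         measure M (space M) * (\<integral>x. (\<Prod>b\<in>Basis. (x \<bullet> b) ^ \<alpha> b) \<partial>N)"
  using \<alpha> by (cases rule: monomial_deg_le_2_cases) (use assms(1,2) in \<open>auto simp: isotropic_def\<close>)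

text \<open>After normalising the total mass, all isotropic measures on the sphere give the same integrals of
  polynomials of degree at most two.\<close>

lemma isotropic_integral_poly:
  fixes M :: "'a::euclidean_space measure"
  assumes M: "finite_measure M" "sets M = sets sphere_borel" "isotropic M"
    and N: "finite_measure N" "sets N = sets sphere_borel" "isotropic N"
    and f: "f \<in> polys_deg_le 2"
  shows "measure N (space N) * (\<integral>x. f x \<partial>M) = measure M (space M) * (\<integral>x. f x \<partial>N)"
proof -
  from f obtain J c where J: "finite J" "\<And>\<alpha>. \<alpha> \<in> J \<Longrightarrow> (\<Sum>b\<in>Basis. \<alpha> b) \<le> 2"
      and f: "f = (\<lambda>x. \<Sum>\<alpha>\<in>J. c \<alpha> * (\<Prod>b\<in>Basis. (x \<bullet> b) ^ \<alpha> b))"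
    by (auto simp: polys_deg_le_def)
  have lin: "(\<integral>x. f x \<partial>L) = (\<Sum>\<alpha>\<in>J. c \<alpha> * (\<integral>x. (\<Prod>b\<in>Basis. (x \<bullet> b) ^ \<alpha> b) \<partial>L))"
    if "finite_measure L" "sets L = sets sphere_borel" for L :: "'a measure"
  proof -
    have "integrable L (\<lambda>x. (\<Prod>b\<in>Basis. (x \<bullet> b) ^ \<alpha> b))" for \<alpha>
      using that by (rule integrable_continuous_on_sphere) (intro continuous_intros)
    then show ?thesis unfolding f by simp
  qed
  show ?thesis
    unfolding lin[OF M(1,2)] lin[OF N(1,2)] sum_distrib_left
    using isotropic_integral_monomial[OF M(3) N(3) J(2)]
    by (intro sum.cong) (auto simp: algebra_simps)
qed

lemma annihilates_mean_zero_polys_2_iff_isotropic: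
  fixes \<nu> :: "'a::euclidean_space measure"
  assumes prob: "prob_space \<nu>" and sets: "sets \<nu> = sets sphere_borel"
  shows "(\<forall>f\<in>mean_zero_polys 2. (\<integral>x. f x \<partial>\<nu>) = 0) \<longleftrightarrow> isotropic \<nu>"
proof
  interpret prob_space \<nu> by fact
  let ?\<sigma> = "sphere_measure :: 'a measure"
  note \<sigma> = isotropic_sphere_measure[where 'a = 'a, unfolded isotropic_def]
  assume ann: "\<forall>f\<in>mean_zero_polys 2. (\<integral>x. f x \<partial>\<nu>) = 0"
  have int: "integrable M (\<lambda>x. (x \<bullet> b) * (x \<bullet> c))"
    if "finite_measure M" "sets M = sets sphere_borel" for M :: "'a measure" and b c
    using that by (rule integrable_continuous_on_sphere) (intro continuous_intros)
  show "isotropic \<nu>"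
  proof (rule isotropicI[OF _ sets])
    show "finite_measure \<nu>" by unfold_locales
  next
    fix b :: 'a assume "b \<in> Basis"
    then have "(\<lambda>x. x \<bullet> b) \<in> mean_zero_polys 2"
      using \<sigma> by (simp add: mean_zero_polys_def inner_Basis_in_polys)
    with ann show "(\<integral>x. x \<bullet> b \<partial>\<nu>) = 0" by blast
  next
    fix b c :: 'a assume "b \<in> Basis" "c \<in> Basis" "b \<noteq> c"
    then have "(\<lambda>x. (x \<bullet> b) * (x \<bullet> c)) \<in> mean_zero_polys 2"
      using \<sigma> by (simp add: mean_zero_polys_def inner_Basis_mult_in_polys)
    with ann show "(\<integral>x. (x \<bullet> b) * (x \<bullet> c) \<partial>\<nu>) = 0" by blast
  next
    fix b c :: 'a assume bc: "b \<in> Basis" "c \<in> Basis"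
    let ?f = "\<lambda>x. (x \<bullet> b) * (x \<bullet> b) - (x \<bullet> c) * (x \<bullet> c)"
    have "(\<integral>x. ?f x \<partial>?\<sigma>) = 0"
      using \<sigma> bc int[OF finite_measure_sphere_measure sets_sphere_measure] by simp
    then have "?f \<in> mean_zero_polys 2"
      using bc by (simp add: mean_zero_polys_def polys_deg_le_diff inner_Basis_mult_in_polys)
    with ann have "(\<integral>x. ?f x \<partial>\<nu>) = 0" by blast
    moreover have "finite_measure \<nu>" by unfold_locales
    ultimately show "(\<integral>x. (x \<bullet> b)^2 \<partial>\<nu>) = (\<integral>x. (x \<bullet> c)^2 \<partial>\<nu>)"
      using int[OF _ sets] by (simp add: power2_eq_square)
  qed
next
  interpret prob_space \<nu> by fact
  assume iso: "isotropic \<nu>"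
  have fin: "finite_measure \<nu>" by unfold_locales
  show "\<forall>f\<in>mean_zero_polys 2. (\<integral>x. f x \<partial>\<nu>) = 0"
  proof
    fix f :: "'a \<Rightarrow> real" assume f: "f \<in> mean_zero_polys 2"
    then have "measure sphere_measure (space (sphere_measure :: 'a measure)) * (\<integral>x. f x \<partial>\<nu>) = 0"
      using isotropic_integral_poly[OF fin sets iso finite_measure_sphere_measure
          sets_sphere_measure isotropic_sphere_measure, of f]
      by (simp add: mean_zero_polys_def)
    then show "(\<integral>x. f x \<partial>\<nu>) = 0"
      using measure_sphere_measure_pos[where 'a = 'a] by simp
  qed
qed

section \<open>Atoms of isotropic probability measures\<close>

lemma isotropic_integral_inner:
  fixes M :: "'a::euclidean_space measure"
  assumes M: "finite_measure M" "sets M = sets sphere_borel" "isotropic M"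
  shows "(\<integral>y. x \<bullet> y \<partial>M) = 0"
proof -
  have int: "integrable M (\<lambda>y. y \<bullet> b)" for b
    using M(1,2) by (rule integrable_continuous_on_sphere) (intro continuous_intros)
  have "(\<integral>y. x \<bullet> y \<partial>M) = (\<integral>y. (\<Sum>b\<in>Basis. (x \<bullet> b) * (y \<bullet> b)) \<partial>M)"
    by (subst euclidean_inner) (rule refl)
  also have "\<dots> = (\<Sum>b\<in>Basis. (x \<bullet> b) * (\<integral>y. y \<bullet> b \<partial>M))"
    using int by simp
  also have "\<dots> = 0"
    using M(3) by (simp add: isotropic_def)
  finally show ?thesis .
qed

lemma isotropic_integral_inner_square:
  fixes M :: "'a::euclidean_space measure"
  assumes M: "finite_measure M" "sets M = sets sphere_borel" "isotropic M"
  shows "(\<integral>y. (x \<bullet> y)^2 \<partial>M) = (norm x)^2 * measure M (space M) / DIM('a)"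
proof -
  let ?m = "measure M (space M) / DIM('a)"
  have int: "integrable M (\<lambda>y. (y \<bullet> b) * (y \<bullet> c))" for b c
    using M(1,2) by (rule integrable_continuous_on_sphere) (intro continuous_intros)
  have "(x \<bullet> y)^2 = (\<Sum>b\<in>Basis. \<Sum>c\<in>Basis. (x \<bullet> b) * (x \<bullet> c) * ((y \<bullet> b) * (y \<bullet> c)))" for y
    unfolding power2_eq_square euclidean_inner[of x y] sum_product
    by (simp add: algebra_simps)
  then have "(\<integral>y. (x \<bullet> y)^2 \<partial>M) =
      (\<Sum>b\<in>Basis. \<Sum>c\<in>Basis. (x \<bullet> b) * (x \<bullet> c) * (\<integral>y. (y \<bullet> b) * (y \<bullet> c) \<partial>M))"
    using int by simp
  also have "\<dots> = (\<Sum>b\<in>Basis. \<Sum>c\<in>Basis. if c = b then (x \<bullet> b)^2 * ?m else 0)"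
    using M(3) by (intro sum.cong) (auto simp: isotropic_def power2_eq_square)
  also have "\<dots> = (\<Sum>b\<in>Basis. (x \<bullet> b) * (x \<bullet> b)) * ?m"
    unfolding sum_distrib_right by (simp add: power2_eq_square)
  also have "(\<Sum>b\<in>Basis. (x \<bullet> b) * (x \<bullet> b)) = (norm x)^2"
    by (metis euclidean_inner power2_norm_eq_inner)
  finally show ?thesis by simp
qed

text \<open>The square of the affine function that vanishes where the inner product with \<open>x\<close> is \<open>- 1 / d\<close>, the
  value at the other vertices of an inscribed regular simplex with vertex \<open>x\<close>.\<close>

lemma isotropic_integral_test_polynomial:
  fixes M :: "'a::euclidean_space measure"
  assumes prob: "prob_space M" and M: "sets M = sets sphere_borel" "isotropic M"
    and x: "norm x = 1"
  shows "(\<integral>y. (1 + DIM('a) * (x \<bullet> y))^2 \<partial>M) = 1 + DIM('a)"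
proof -
  interpret prob_space M by fact
  have fin: "finite_measure M" by unfold_locales
  have int: "integrable M (\<lambda>y. x \<bullet> y)" "integrable M (\<lambda>y. (x \<bullet> y)^2)"
    using fin M(1) by (rule integrable_continuous_on_sphere, intro continuous_intros)+
  have "(\<integral>y. (1 + DIM('a) * (x \<bullet> y))^2 \<partial>M) =
        (\<integral>y. 1 + 2 * DIM('a) * (x \<bullet> y) + (DIM('a))^2 * (x \<bullet> y)^2 \<partial>M)"
    by (intro Bochner_Integration.integral_cong) (auto simp: power2_eq_square algebra_simps)
  also have "\<dots> = 1 + 2 * DIM('a) * (\<integral>y. x \<bullet> y \<partial>M) + (DIM('a))^2 * (\<integral>y. (x \<bullet> y)^2 \<partial>M)"
    using int by (simp add: prob_space)
  also have "\<dots> = 1 + DIM('a)"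
    unfolding isotropic_integral_inner[OF fin M] isotropic_integral_inner_square[OF fin M] x
    by (simp add: prob_space power2_eq_square)
  finally show ?thesis .
qed

lemma sum_atoms_le_integral:
  fixes g :: "'a::euclidean_space \<Rightarrow> real"
  assumes prob: "prob_space M" and sets: "sets M = sets sphere_borel"
    and F: "finite F" "F \<subseteq> sphere 0 1"
    and g: "continuous_on (sphere 0 1) g" "\<And>y. 0 \<le> g y"
  shows "(\<Sum>x\<in>F. measure M {x} * g x) \<le> (\<integral>y. g y \<partial>M)"
proof -
  interpret prob_space M by fact
  have fin: "finite_measure M" by unfold_locales
  have sing: "{x} \<in> sets M" if "x \<in> F" for x
    using that F unfolding sets by (intro countable_in_sphere_borel) auto
  have int: "integrable M (\<lambda>y. indicator {x} y * g x :: real)" if "x \<in> F" for x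
    using sing[OF that] by (simp add: emeasure_eq_measure)
  have "(\<Sum>x\<in>F. measure M {x} * g x) = (\<Sum>x\<in>F. (\<integral>y. indicator {x} y * g x \<partial>M))"
    using sing sets.sets_into_space by (intro sum.cong) (auto simp: Int_absorb1)
  also have "\<dots> = (\<integral>y. (\<Sum>x\<in>F. indicator {x} y * g x) \<partial>M)"
    using int by simp
  also have "\<dots> \<le> (\<integral>y. g y \<partial>M)"
  proof (rule integral_mono)
    show "integrable M (\<lambda>y. \<Sum>x\<in>F. indicator {x} y * g x)" using int by simp
    show "integrable M g" by (rule integrable_continuous_on_sphere[OF fin sets g(1)])
    fix y
    have "(\<Sum>x\<in>F. indicator {x} y * g x) = (\<Sum>x\<in>F. if x = y then g y else 0)"
      by (intro sum.cong) auto
    then show "(\<Sum>x\<in>F. indicator {x} y * g x) \<le> g y" using F(1) g(2) by simp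
  qed
  finally show ?thesis .
qed

lemma isotropic_sum_atoms_le:
  fixes M :: "'a::euclidean_space measure"
  assumes "prob_space M" "sets M = sets sphere_borel" "isotropic M"
    and "norm x = 1" "finite F" "F \<subseteq> sphere 0 1"
  shows "(\<Sum>y\<in>F. measure M {y} * (1 + DIM('a) * (x \<bullet> y))^2) \<le> 1 + DIM('a)"
proof -
  have "(\<Sum>y\<in>F. measure M {y} * (1 + DIM('a) * (x \<bullet> y))^2) \<le>
        (\<integral>y. (1 + DIM('a) * (x \<bullet> y))^2 \<partial>M)"
    by (intro sum_atoms_le_integral assms continuous_intros) simp
  then show ?thesis by (simp only: isotropic_integral_test_polynomial[OF assms(1-4)])
qed

lemma isotropic_atom_le:
  fixes M :: "'a::euclidean_space measure"
  assumes "prob_space M" "sets M = sets sphere_borel" "isotropic M" and x: "norm x = 1"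
  shows "measure M {x} \<le> 1 / (1 + real DIM('a))"
proof -
  have "x \<bullet> x = 1" using x by (simp add: norm_eq_sqrt_inner)
  then have "(measure M {x} * (1 + real DIM('a))) * (1 + real DIM('a)) \<le> 1 * (1 + real DIM('a))"
    using isotropic_sum_atoms_le[OF assms, of "{x}"] x by (simp add: power2_eq_square algebra_simps)
  then have "measure M {x} * (1 + real DIM('a)) \<le> 1"
    by (rule mult_right_le_imp_le) simp
  then show ?thesis by (simp add: field_simps)
qed

text \<open>If \<open>x\<close> has the largest possible mass, its term alone exhausts the integral of the test polynomial,
  which must therefore vanish at all other atoms.\<close>

lemma isotropic_atoms_inner:
  fixes M :: "'a::euclidean_space measure"
  assumes M: "prob_space M" "sets M = sets sphere_borel" "isotropic M"
    and x: "norm x = 1" "measure M {x} = 1 / (1 + real DIM('a))"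
    and y: "norm y = 1" "measure M {y} > 0" and "x \<noteq> y"
  shows "x \<bullet> y = - 1 / DIM('a)"
proof -
  have "x \<bullet> x = 1" using x by (simp add: norm_eq_sqrt_inner)
  then have "measure M {x} * (1 + real DIM('a))^2 = 1 + real DIM('a)"
    using x(2) by (simp add: power2_eq_square)
  then have "measure M {y} * (1 + DIM('a) * (x \<bullet> y))^2 \<le> 0"
    using isotropic_sum_atoms_le[OF M x(1), of "{x, y}"] \<open>x \<noteq> y\<close> x(1) y(1) \<open>x \<bullet> x = 1\<close> by simp
  with y(2) have "1 + DIM('a) * (x \<bullet> y) = 0"
    by (simp add: mult_le_0_iff)
  then show ?thesis by (simp add: field_simps)
qed

section \<open>Sums of powers of the atoms\<close>

text \<open>The countable set \<open>C\<close> of full measure may contain points of mass zero; discarding them leaves exactly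
  the atoms.\<close>

lemma atoms_of_countably_supported:
  fixes \<nu> :: "'a::euclidean_space measure"
  assumes prob: "prob_space \<nu>" and sets: "sets \<nu> = sets sphere_borel"
    and C: "countable C" "C \<subseteq> sphere 0 1" "emeasure \<nu> C = 1"
  shows "countable (atoms \<nu>)" and "measure \<nu> (atoms \<nu>) = 1"
proof -
  interpret prob_space \<nu> by fact
  have in_sets: "A \<in> sets \<nu>" if "countable A" "A \<subseteq> sphere 0 1" for A
    unfolding sets using that by (rule countable_in_sphere_borel)
  have C1: "measure \<nu> C = 1" using C(3) by (simp add: measure_def)
  have sub: "atoms \<nu> \<subseteq> C"
  proof
    fix x assume x: "x \<in> atoms \<nu>"
    show "x \<in> C"
    proof (rule ccontr)
      assume "x \<notin> C"
      then have "measure \<nu> (C \<union> {x}) = measure \<nu> C + measure \<nu> {x}"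
        using C x by (intro finite_measure_Union in_sets) (auto simp: atoms_def)
      then show False
        using prob_le_1[of "C \<union> {x}"] x C1 by (simp add: atoms_def)
    qed
  qed
  then show cA: "countable (atoms \<nu>)" using C(1) countable_subset by blast
  have "(\<Union>x\<in>C - atoms \<nu>. {x}) \<in> null_sets \<nu>"
  proof (rule null_sets_UN')
    fix x assume "x \<in> C - atoms \<nu>"
    with C(2) have "measure \<nu> {x} = 0" "{x} \<in> sets \<nu>"
      by (auto simp: atoms_def zero_less_measure_iff intro!: in_sets)
    then show "{x} \<in> null_sets \<nu>" by (auto simp: null_sets_def emeasure_eq_measure)
  qed (use C(1) in auto)
  then have "measure \<nu> (C - (C - atoms \<nu>)) = measure \<nu> C"
    using C by (intro measure_Diff_null_set in_sets) auto
  with sub C1 show "measure \<nu> (atoms \<nu>) = 1" by (simp add: double_diff)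
qed

lemma sum_le_power_sum:
  assumes "finite F" "F \<subseteq> atoms \<nu>"
  shows "ennreal (\<Sum>x\<in>F. measure \<nu> {x} powr \<theta>) \<le> power_sum \<theta> \<nu>"
  unfolding power_sum_def using assms
  by (subst nonneg_infsum_complete) (auto simp flip: sum_ennreal intro!: SUP_upper)

text \<open>The linear lower bound on \<open>t\<^sup>\<theta>\<close> is summed over all atoms. The gain at a chosen atom \<open>x\<^sub>0\<close> is kept,
  because the equality case needs it.\<close>

lemma power_sum_ge:
  fixes \<nu> :: "'a::euclidean_space measure"
  assumes prob: "prob_space \<nu>" and sets: "sets \<nu> = sets sphere_borel"
    and cA: "countable (atoms \<nu>)" and A1: "measure \<nu> (atoms \<nu>) = 1"
    and K: "\<And>x. x \<in> atoms \<nu> \<Longrightarrow> K * measure \<nu> {x} \<le> measure \<nu> {x} powr \<theta>"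
    and x\<^sub>0: "x\<^sub>0 \<in> atoms \<nu>"
  shows "ennreal (K + (measure \<nu> {x\<^sub>0} powr \<theta> - K * measure \<nu> {x\<^sub>0})) \<le> power_sum \<theta> \<nu>"
proof -
  interpret prob_space \<nu> by fact
  let ?m = "\<lambda>x. measure \<nu> {x}"
  define \<delta> where "\<delta> = ?m x\<^sub>0 powr \<theta> - K * ?m x\<^sub>0"
  \<comment> \<open>An increasing exhaustion of the atoms by finite sets; the enumeration repeats atoms if there are
      only finitely many.\<close>
  define F where "F n = from_nat_into (atoms \<nu>) ` {..n}" for n :: nat
  have in_sets: "A \<in> sets \<nu>" if "A \<subseteq> atoms \<nu>" for A
    unfolding sets using that cA countable_subset[OF that]
    by (intro countable_in_sphere_borel) (auto simp: atoms_def)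
  have F: "finite (F n)" "F n \<subseteq> atoms \<nu>" for n
    using x\<^sub>0 from_nat_into[of "atoms \<nu>"] by (auto simp: F_def)
  have "(\<Union>n. F n) = range (from_nat_into (atoms \<nu>))" by (auto simp: F_def)
  also have "\<dots> = atoms \<nu>" using cA x\<^sub>0 by (intro range_from_nat_into) auto
  finally have UF: "(\<Union>n. F n) = atoms \<nu>" .
  have "(\<lambda>n. measure \<nu> (F n)) \<longlonglongrightarrow> measure \<nu> (\<Union>n. F n)"
    using in_sets F(2) by (intro finite_Lim_measure_incseq) (auto simp: incseq_def F_def)
  then have lim: "(\<lambda>n. ennreal (K * measure \<nu> (F n) + \<delta>)) \<longlonglongrightarrow> ennreal (K * 1 + \<delta>)"
    unfolding UF A1 by (intro tendsto_ennrealI tendsto_intros)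
  obtain N where N: "x\<^sub>0 \<in> F N" using UF x\<^sub>0 by blast
  have "ennreal (K * measure \<nu> (F n) + \<delta>) \<le> power_sum \<theta> \<nu>" if "n \<ge> N" for n
  proof -
    have xF: "x\<^sub>0 \<in> F n" using N that by (auto simp: F_def)
    have sing: "{x} \<in> sets \<nu>" if "x \<in> F n" for x
      using that F(2) by (intro in_sets) auto
    have "measure \<nu> (F n) = (\<Sum>x\<in>F n. ?m x)"
      using F(1) sing by (intro measure_eq_sum_singleton) (auto simp: emeasure_eq_measure)
    then have "K * measure \<nu> (F n) + \<delta> = (\<Sum>x\<in>F n - {x\<^sub>0}. K * ?m x) + ?m x\<^sub>0 powr \<theta>"
      using F(1) xF by (simp add: \<delta>_def sum_distrib_left[symmetric] sum.remove[of _ x\<^sub>0] distrib_left)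
    also have "\<dots> \<le> (\<Sum>x\<in>F n - {x\<^sub>0}. ?m x powr \<theta>) + ?m x\<^sub>0 powr \<theta>"
      using F(2)[of n] K by (intro add_right_mono sum_mono) auto
    also have "\<dots> = (\<Sum>x\<in>F n. ?m x powr \<theta>)"
      using F(1) xF by (simp add: sum.remove[of _ x\<^sub>0])
    finally have "ennreal (K * measure \<nu> (F n) + \<delta>) \<le> ennreal (\<Sum>x\<in>F n. ?m x powr \<theta>)"
      by (rule ennreal_leI)
    also have "\<dots> \<le> power_sum \<theta> \<nu>" using F by (rule sum_le_power_sum)
    finally show ?thesis .
  qed
  then have "ennreal (K * 1 + \<delta>) \<le> power_sum \<theta> \<nu>"
    by (intro LIMSEQ_le_const2[OF lim]) auto
  then show ?thesis by (simp add: \<delta>_def)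
qed

text \<open>The line through \<open>0\<close> and the point of the graph of \<open>t \<mapsto> t\<^sup>\<theta>\<close> at \<open>t = 1 / N\<close> stays below that graph
  on \<open>(0, 1 / N]\<close>, since \<open>t\<^sup>\<theta> / t\<close> is strictly decreasing for \<open>\<theta> < 1\<close>.\<close>

lemma powr_ge_linear:
  fixes t :: real
  assumes "0 < t" "t \<le> 1 / N" "0 < N" "\<theta> < 1"
  shows "N powr (1 - \<theta>) * t \<le> t powr \<theta>"
    and "t \<noteq> 1 / N \<Longrightarrow> N powr (1 - \<theta>) * t < t powr \<theta>"
proof -
  have eq: "N powr (1 - \<theta>) * t = (N * t) powr (1 - \<theta>) * t powr \<theta>"
    using assms by (simp add: powr_mult powr_add[symmetric] mult.assoc)
  have "N * t \<le> 1" using assms by (simp add: field_simps)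
  then have "(N * t) powr (1 - \<theta>) \<le> 1 powr (1 - \<theta>)"
    using assms by (intro powr_mono2) auto
  then show "N powr (1 - \<theta>) * t \<le> t powr \<theta>"
    unfolding eq using mult_right_mono[of _ 1 "t powr \<theta>"] by simp
  assume "t \<noteq> 1 / N"
  then have "N * t < 1" using assms by (auto simp: field_simps)
  then have "(N * t) powr (1 - \<theta>) < 1 powr (1 - \<theta>)"
    using assms by (intro powr_less_mono2) auto
  then show "N powr (1 - \<theta>) * t < t powr \<theta>"
    unfolding eq using mult_strict_right_mono[of _ 1 "t powr \<theta>"] assms by simp
qed

lemma countable_designs_2_iff:
  "\<nu> \<in> countable_designs 2 \<longleftrightarrow> prob_space \<nu> \<and> sets \<nu> = sets sphere_borel \<and>
     (\<exists>C. countable C \<and> C \<subseteq> sphere 0 1 \<and> emeasure \<nu> C = 1) \<and> isotropic \<nu>"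
  using annihilates_mean_zero_polys_2_iff_isotropic[of \<nu>]
  by (auto simp: countable_designs_def)

lemma power_sum_lower_bound:
  fixes \<nu> :: "'a::euclidean_space measure"
  assumes \<nu>: "\<nu> \<in> countable_designs 2" and \<theta>: "\<theta> < 1"
  shows "ennreal ((DIM('a) + 1) powr (1 - \<theta>)) \<le> power_sum \<theta> \<nu>"
    and "power_sum \<theta> \<nu> = ennreal ((DIM('a) + 1) powr (1 - \<theta>)) \<Longrightarrow>
         x \<in> atoms \<nu> \<Longrightarrow> measure \<nu> {x} = 1 / (DIM('a) + 1)"
proof -
  let ?N = "real DIM('a) + 1"
  let ?K = "?N powr (1 - \<theta>)"
  have N: "real (DIM('a) + 1) = ?N" "?N > 0" by auto
  from \<nu> obtain C where prob: "prob_space \<nu>" and sets: "sets \<nu> = sets sphere_borel"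
    and C: "countable C" "C \<subseteq> sphere 0 1" "emeasure \<nu> C = 1" and iso: "isotropic \<nu>"
    by (auto simp: countable_designs_2_iff)
  note cA = atoms_of_countably_supported[OF prob sets C]
  have bound: "0 < measure \<nu> {y}" "measure \<nu> {y} \<le> 1 / ?N" if "y \<in> atoms \<nu>" for y
    using that isotropic_atom_le[OF prob sets iso, of y] by (auto simp: atoms_def add.commute)
  have K: "?K * measure \<nu> {y} \<le> measure \<nu> {y} powr \<theta>" if "y \<in> atoms \<nu>" for y
    using bound[OF that] N(2) \<theta> by (intro powr_ge_linear(1)) auto
  have ge: "ennreal (?K + (measure \<nu> {y} powr \<theta> - ?K * measure \<nu> {y})) \<le> power_sum \<theta> \<nu>"
    if "y \<in> atoms \<nu>" for y
    using K that by (rule power_sum_ge[OF prob sets cA])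
  obtain y where y: "y \<in> atoms \<nu>" using cA(2) by fastforce
  have "ennreal ?K \<le> ennreal (?K + (measure \<nu> {y} powr \<theta> - ?K * measure \<nu> {y}))"
    using K[OF y] by (intro ennreal_leI) simp
  also have "\<dots> \<le> power_sum \<theta> \<nu>" using y by (rule ge)
  finally show "ennreal ((DIM('a) + 1) powr (1 - \<theta>)) \<le> power_sum \<theta> \<nu>" unfolding N(1) .
  assume eq: "power_sum \<theta> \<nu> = ennreal ((DIM('a) + 1) powr (1 - \<theta>))" and x: "x \<in> atoms \<nu>"
  show "measure \<nu> {x} = 1 / (DIM('a) + 1)"
  proof (rule ccontr)
    assume "measure \<nu> {x} \<noteq> 1 / (DIM('a) + 1)"
    then have "?K * measure \<nu> {x} < measure \<nu> {x} powr \<theta>"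
      using bound[OF x] N \<theta> by (intro powr_ge_linear(2)) auto
    then have "ennreal ?K < ennreal (?K + (measure \<nu> {x} powr \<theta> - ?K * measure \<nu> {x}))"
      by (intro ennreal_lessI) (auto intro!: add_nonneg_pos)
    also have "\<dots> \<le> power_sum \<theta> \<nu>" using x by (rule ge)
    finally show False using eq unfolding N(1) by simp
  qed
qed

section \<open>Regular simplices inscribed in the sphere\<close>

lemma regular_simplex_vertices_of_inner:
  fixes V :: "'a::euclidean_space set"
  assumes sphere: "V \<subseteq> sphere 0 1" and fin: "finite V" "card V = DIM('a) + 1"
    and inner: "\<And>x y. x \<in> V \<Longrightarrow> y \<in> V \<Longrightarrow> x \<noteq> y \<Longrightarrow> x \<bullet> y = - 1 / DIM('a)"
  shows "regular_simplex_vertices DIM('a) V"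
proof -
  have self: "x \<bullet> x = 1" if "x \<in> V" for x
    using that sphere by (auto simp: norm_eq_sqrt_inner)
  have "\<not> affine_dependent V"
  proof
    assume "affine_dependent V"
    then obtain U v where U: "sum U V = 0" "(\<Sum>x\<in>V. U x *\<^sub>R x) = 0" and v: "v \<in> V" "U v \<noteq> 0"
      using affine_dependent_explicit_finite[OF fin(1)] by auto
    have "0 = (\<Sum>x\<in>V. U x * (x \<bullet> v))"
      using arg_cong[OF U(2), of "\<lambda>w. w \<bullet> v"] by (simp add: inner_sum_left)
    also have "\<dots> = U v + (\<Sum>x\<in>V - {v}. U x * (x \<bullet> v))"
      using v fin(1) by (simp add: sum.remove[of V v] self)
    also have "(\<Sum>x\<in>V - {v}. U x * (x \<bullet> v)) = (\<Sum>x\<in>V - {v}. U x * (- 1 / DIM('a)))"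
      using v inner by (intro sum.cong) auto
    also have "\<dots> = U v / DIM('a)"
      using U(1) v fin(1) unfolding sum_distrib_right[symmetric] by (simp add: sum_diff1)
    finally have "U v * (1 + 1 / DIM('a)) = 0" by (simp add: field_simps)
    then have "U v = 0 \<or> 1 + 1 / real DIM('a) = 0" by simp
    moreover have "1 + 1 / real DIM('a) > 0" by (simp add: add_pos_nonneg)
    ultimately show False using v by simp
  qed
  moreover have "dist x y = sqrt (2 + 2 / DIM('a))" if "x \<in> V" "y \<in> V" "x \<noteq> y" for x y
  proof -
    have "(x - y) \<bullet> (x - y) = 2 + 2 / DIM('a)"
      using that by (simp add: inner_diff_left inner_diff_right self inner inner_commute)
    then show ?thesis by (simp add: dist_norm norm_eq_sqrt_inner)
  qed
  ultimately show ?thesis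
    unfolding regular_simplex_vertices_def using fin by (auto simp: pairwise_def)
qed

text \<open>All inner products between distinct vertices agree, so the linear functional \<open>x \<mapsto> \<Sum>V \<bullet> x\<close> takes
  the same value at all vertices. The affine hull of the vertices is the whole space; hence this
  functional is constant, and the second identity, linear in \<open>x\<close>, need only be checked at the
  vertices.\<close>

lemma regular_simplex_vertices_tight_frame:
  fixes V :: "'a::euclidean_space set"
  assumes V: "regular_simplex_vertices DIM('a) V" and sphere: "V \<subseteq> sphere 0 1"
  shows "\<Sum>V = 0" and "(\<Sum>v\<in>V. (v \<bullet> x) *\<^sub>R v) = (1 + 1 / DIM('a)) *\<^sub>R x"
proof -
  obtain d where aff: "\<not> affine_dependent V" and card: "card V = DIM('a) + 1"
    and d: "\<And>x y. x \<in> V \<Longrightarrow> y \<in> V \<Longrightarrow> x \<noteq> y \<Longrightarrow> dist x y = d"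
    using V by (auto simp: regular_simplex_vertices_def pairwise_def)
  have fin: "finite V" using card by (metis card.infinite add_is_0 one_neq_zero)
  have full: "affine hull V = UNIV"
    using aff_dim_affine_independent[OF aff] card by (simp flip: aff_dim_eq_full)
  have self: "x \<bullet> x = 1" if "x \<in> V" for x
    using that sphere by (auto simp: norm_eq_sqrt_inner)
  define c where "c = 1 - d^2 / 2"
  have c: "x \<bullet> y = c" if "x \<in> V" "y \<in> V" "x \<noteq> y" for x y
  proof -
    have "d^2 = (x - y) \<bullet> (x - y)"
      using d[OF that] by (simp add: dist_norm flip: power2_norm_eq_inner)
    also have "\<dots> = 2 - 2 * (x \<bullet> y)"
      using that by (simp add: inner_diff_left inner_diff_right self inner_commute)
    finally show ?thesis by (simp add: c_def field_simps)
  qed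
  have rest: "\<Sum>(V - {v}) = \<Sum>V - v" if "v \<in> V" for v
    using that fin by (simp add: sum_diff1)
  have s: "\<Sum>V \<bullet> v = 1 + DIM('a) * c" if v: "v \<in> V" for v
  proof -
    have "\<Sum>V \<bullet> v = v \<bullet> v + (\<Sum>x\<in>V - {v}. x \<bullet> v)"
      unfolding inner_sum_left using fin v by (rule sum.remove)
    also have "(\<Sum>x\<in>V - {v}. x \<bullet> v) = (\<Sum>x\<in>V - {v}. c)"
      using v c by (intro sum.cong) auto
    finally show ?thesis using v fin card by (simp add: self)
  qed
  have "affine {x. \<Sum>V \<bullet> x = 1 + DIM('a) * c}"
    by (rule affine_hyperplane)
  then have "affine hull V \<subseteq> {x. \<Sum>V \<bullet> x = 1 + DIM('a) * c}"
    using s by (intro hull_minimal) auto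
  then have const: "\<Sum>V \<bullet> x = 1 + DIM('a) * c" for x
    using full by auto
  \<comment> \<open>A linear functional that is constant on the whole space is zero.\<close>
  from const[of 0] have c_eq: "1 + DIM('a) * c = 0" by simp
  with const[of "\<Sum>V"] show sum0: "\<Sum>V = 0" by simp
  \<comment> \<open>The vanishing constant also determines the common inner product.\<close>
  from c_eq have c_eq: "c = - 1 / DIM('a)" by (simp add: field_simps)
  define T where "T x = (\<Sum>v\<in>V. (v \<bullet> x) *\<^sub>R v)" for x
  have T: "T w = (1 + 1 / DIM('a)) *\<^sub>R w" if w: "w \<in> V" for w
  proof -
    have "T w = w + (\<Sum>v\<in>V - {w}. (v \<bullet> w) *\<^sub>R v)"
      unfolding T_def using w fin by (simp add: sum.remove[of V w] self)
    also have "(\<Sum>v\<in>V - {w}. (v \<bullet> w) *\<^sub>R v) = c *\<^sub>R \<Sum>(V - {w})"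
      unfolding scaleR_sum_right using w c by (intro sum.cong) auto
    finally show ?thesis
      using rest[OF w] sum0 c_eq by (simp add: algebra_simps)
  qed
  have "linear (\<lambda>x. T x - (1 + 1 / DIM('a)) *\<^sub>R x)"
    by (rule linearI) (simp_all add: T_def inner_add_right algebra_simps sum.distrib scaleR_sum_right)
  then have "subspace {x. T x - (1 + 1 / DIM('a)) *\<^sub>R x = 0}"
    by (rule linear_subspace_kernel)
  then have "affine hull V \<subseteq> {x. T x - (1 + 1 / DIM('a)) *\<^sub>R x = 0}"
    using T by (intro hull_minimal subspace_imp_affine) auto
  then show "(\<Sum>v\<in>V. (v \<bullet> x) *\<^sub>R v) = (1 + 1 / DIM('a)) *\<^sub>R x"
    using full by (auto simp: T_def)
qed

text \<open>The vertices are \<open>\<alpha> b + \<beta> e\<close> for the basis vectors \<open>b\<close>, together with the unit vector opposite to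
  \<open>e\<close>, where \<open>e\<close> is the sum of the basis vectors. The coefficients solve the two equations
  \<open>\<alpha> + d \<beta> = 1 / sqrt d\<close> and \<open>\<alpha>\<^sup>2 = 1 + 1/d\<close>, which express that the vertices are
  unit vectors with pairwise inner products \<open>- 1 / d\<close>.\<close>

lemma exists_regular_simplex:
  obtains V :: "'a::euclidean_space set"
  where "V \<subseteq> sphere 0 1" "regular_simplex_vertices DIM('a) V"
proof -
  define d where "d = real DIM('a)"
  have d: "d > 0" by (simp add: d_def)
  define e :: 'a where "e = \<Sum>Basis"
  have e: "e \<bullet> b = 1" "b \<bullet> e = 1" if "b \<in> Basis" for b
    using that by (simp_all add: e_def inner_sum_left inner_commute[of b] inner_Basis)
  have ee: "e \<bullet> e = d"
    by (subst (1) e_def) (simp add: inner_sum_left e d_def)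
  define \<alpha> where "\<alpha> = sqrt (1 + 1 / d)"
  define r where "r = 1 / sqrt d"
  define \<beta> where "\<beta> = (r - \<alpha>) / d"
  have \<alpha>: "\<alpha>^2 = 1 + 1 / d" using d by (simp add: \<alpha>_def)
  have r: "r^2 = 1 / d" using d by (simp add: r_def power_divide)
  have \<beta>: "d * \<beta> = r - \<alpha>" using d by (simp add: \<beta>_def)
  have cross: "2 * \<alpha> * \<beta> + \<beta>^2 * d = - 1 / d"
  proof -
    have "d * (2 * \<alpha> * \<beta> + \<beta>^2 * d) = (d * \<beta>) * (2 * \<alpha> + d * \<beta>)"
      by (simp add: algebra_simps power2_eq_square)
    also have "\<dots> = r^2 - \<alpha>^2" unfolding \<beta> by (simp add: algebra_simps power2_eq_square)
    also have "\<dots> = - 1" by (simp add: r \<alpha>)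
    finally show ?thesis using d by (simp add: field_simps)
  qed
  define v where "v b = \<alpha> *\<^sub>R b + \<beta> *\<^sub>R e" for b
  define w where "w = - r *\<^sub>R e"
  have vv: "v b \<bullet> v c = (if b = c then 1 else - 1 / d)" if "b \<in> Basis" "c \<in> Basis" for b c
  proof -
    have "v b \<bullet> v c = \<alpha>^2 * (b \<bullet> c) + (2 * \<alpha> * \<beta> + \<beta>^2 * d)"
      using that by (simp add: v_def inner_add_left inner_add_right e ee power2_eq_square algebra_simps)
    then show ?thesis using that by (simp add: cross \<alpha> inner_Basis)
  qed
  have ww: "w \<bullet> w = 1" using r d by (simp add: w_def ee power2_eq_square field_simps)
  have vw: "v b \<bullet> w = - 1 / d" if "b \<in> Basis" for b
  proof -
    have "v b \<bullet> w = - r * (\<alpha> + d * \<beta>)"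
      using that by (simp add: v_def w_def inner_add_left e ee algebra_simps)
    also have "\<dots> = - (r^2)" unfolding \<beta> by (simp add: power2_eq_square)
    finally show ?thesis by (simp add: r)
  qed
  have ne: "- 1 / d \<noteq> 1" using d by (simp add: field_simps)
  have inj: "inj_on v Basis"
    using vv ne by (intro inj_onI) (metis (full_types))
  have w_notin: "w \<notin> v ` Basis"
    using vw ww ne by auto
  let ?V = "insert w (v ` Basis)"
  have sphere: "?V \<subseteq> sphere 0 1"
    using ww vv by (auto simp: norm_eq_sqrt_inner)
  moreover have "regular_simplex_vertices DIM('a) ?V"
  proof (rule regular_simplex_vertices_of_inner[OF sphere])
    show "card ?V = DIM('a) + 1"
      using w_notin by (simp add: card_image[OF inj])
  next
    fix x y assume "x \<in> ?V" "y \<in> ?V" "x \<noteq> y"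
    then show "x \<bullet> y = - 1 / real DIM('a)"
      using vv vw by (auto simp: d_def[symmetric] inner_commute[of w])
  qed simp
  ultimately show ?thesis by (rule that)
qed

section \<open>Averages of Dirac measures\<close>

lemma is_dirac_average_iff_card:
  fixes \<xi> :: "'i \<Rightarrow> 'a::euclidean_space"
  assumes "finite I"
  shows "is_dirac_average I \<xi> \<nu> \<longleftrightarrow> sets \<nu> = sets sphere_borel \<and>
    (\<forall>A\<in>sets sphere_borel. emeasure \<nu> A = ennreal (card {i \<in> I. \<xi> i \<in> A} / card I))"
proof -
  have "ennreal (1 / real (card I)) * (\<Sum>i\<in>I. emeasure (return sphere_borel (\<xi> i)) A) =
        ennreal (card {i \<in> I. \<xi> i \<in> A} / card I)"
    if A: "A \<in> sets sphere_borel" for A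
  proof -
    have "(\<Sum>i\<in>I. emeasure (return sphere_borel (\<xi> i)) A) = (\<Sum>i\<in>I. ennreal (indicator A (\<xi> i)))"
      using A by (intro sum.cong) (auto simp: indicator_def)
    also have "\<dots> = ennreal (\<Sum>i\<in>I. indicator A (\<xi> i))" by (rule sum_ennreal) simp
    also have "(\<Sum>i\<in>I. indicator A (\<xi> i)) = real (card {i \<in> I. \<xi> i \<in> A})"
      using assms by (simp add: indicator_def sum.If_cases Int_def)
    finally show ?thesis by (simp flip: ennreal_mult'')
  qed
  then show ?thesis by (simp add: is_dirac_average_def)
qed

lemma measurable_uniform_count_measure_sphere:
  assumes "\<xi> ` I \<subseteq> sphere 0 1"
  shows "\<xi> \<in> uniform_count_measure I \<rightarrow>\<^sub>M sphere_borel"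
  using assms
  by (auto simp: measurable_def space_sphere_borel space_uniform_count_measure
      sets_uniform_count_measure)

text \<open>The average is the image of the uniform probability measure on the index set, which reduces
  integrals to finite sums.\<close>

lemma is_dirac_average_iff_distr:
  fixes \<xi> :: "'i \<Rightarrow> 'a::euclidean_space"
  assumes I: "finite I" and \<xi>: "\<xi> ` I \<subseteq> sphere 0 1"
  shows "is_dirac_average I \<xi> \<nu> \<longleftrightarrow> \<nu> = distr (uniform_count_measure I) sphere_borel \<xi>"
proof -
  have "emeasure (distr (uniform_count_measure I) sphere_borel \<xi>) A =
        ennreal (card {i \<in> I. \<xi> i \<in> A} / card I)"
    if A: "A \<in> sets sphere_borel" for A
  proof -
    have "\<xi> -` A \<inter> I = {i \<in> I. \<xi> i \<in> A}" by auto
    then show ?thesis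
      using A I
      by (simp add: emeasure_distr[OF measurable_uniform_count_measure_sphere[OF \<xi>]]
          space_uniform_count_measure emeasure_uniform_count_measure)
  qed
  then show ?thesis
    unfolding is_dirac_average_iff_card[OF I] by (auto intro: measure_eqI)
qed

lemma integral_dirac_average:
  fixes \<xi> :: "'i \<Rightarrow> 'a::euclidean_space" and f :: "'a \<Rightarrow> real"
  assumes I: "finite I" and \<xi>: "\<xi> ` I \<subseteq> sphere 0 1"
    and \<nu>: "is_dirac_average I \<xi> \<nu>" and f: "f \<in> borel_measurable sphere_borel"
  shows "(\<integral>x. f x \<partial>\<nu>) = (\<Sum>i\<in>I. f (\<xi> i)) / card I"
proof -
  have "\<nu> = distr (uniform_count_measure I) sphere_borel \<xi>"
    using \<nu> is_dirac_average_iff_distr[OF I \<xi>] by simp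
  then show ?thesis
    using I by (simp add: integral_distr[OF measurable_uniform_count_measure_sphere[OF \<xi>] f]
        integral_uniform_count_measure)
qed

text \<open>The tight frame identities are the moment conditions for the average. The \<open>\<xi> i\<close> are distinct, as there
  are as many vertices as indices, so each vertex is an atom of mass \<open>1 / (d + 1)\<close>.\<close>

lemma regular_simplex_average:
  fixes \<xi> :: "'i \<Rightarrow> 'a::euclidean_space"
  assumes I: "finite I" "card I = DIM('a) + 1" and \<xi>: "\<xi> ` I \<subseteq> sphere 0 1"
    and simplex: "regular_simplex_vertices DIM('a) (\<xi> ` I)"
    and \<nu>: "is_dirac_average I \<xi> \<nu>"
  shows "\<nu> \<in> countable_designs 2"
    and "power_sum \<theta> \<nu> = ennreal ((DIM('a) + 1) powr (1 - \<theta>))"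
proof -
  have inj: "inj_on \<xi> I"
    using simplex I by (intro eq_card_imp_inj_on) (auto simp: regular_simplex_vertices_def)
  have sets: "sets \<nu> = sets sphere_borel" using \<nu> by (simp add: is_dirac_average_def)
  have emeasure: "emeasure \<nu> A = ennreal (card {i \<in> I. \<xi> i \<in> A} / card I)"
    if "A \<in> sets sphere_borel" for A
    using \<nu> that by (simp add: is_dirac_average_iff_card[OF I(1)])
  have space: "space \<nu> = sphere 0 1"
    using sets_eq_imp_space_eq[OF sets] by (simp add: space_sphere_borel)
  have one: "emeasure \<nu> A = 1" if "\<xi> ` I \<subseteq> A" "A \<in> sets sphere_borel" for A
  proof -
    have "{i \<in> I. \<xi> i \<in> A} = I" using that by auto
    then show ?thesis using emeasure[OF that(2)] I by simp
  qed
  have prob: "prob_space \<nu>"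
    by (rule prob_spaceI, rule one) (use \<xi> space sets.top[of \<nu>] sets in auto)
  interpret prob_space \<nu> by (rule prob)
  have integral: "(\<integral>x. f x \<partial>\<nu>) = (\<Sum>v\<in>\<xi> ` I. f v) / (DIM('a) + 1)"
    if "continuous_on (sphere 0 1) f" for f
  proof -
    have "f \<in> borel_measurable sphere_borel"
      unfolding sphere_borel_def by (rule borel_measurable_continuous_on_restrict[OF that])
    then show ?thesis
      using integral_dirac_average[OF I(1) \<xi> \<nu>] I(2) by (simp add: sum.reindex[OF inj])
  qed
  note frame = regular_simplex_vertices_tight_frame[OF simplex \<xi>]
  have "isotropic \<nu>"
    unfolding isotropic_def
  proof (intro conjI ballI)
    fix b :: 'a
    have "(\<Sum>v\<in>\<xi> ` I. v \<bullet> b) = 0"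
      using arg_cong[OF frame(1), of "\<lambda>s. s \<bullet> b"] by (simp add: inner_sum_left)
    then show "(\<integral>x. x \<bullet> b \<partial>\<nu>) = 0"
      by (subst integral) (auto intro!: continuous_intros)
  next
    fix b c :: 'a assume bc: "b \<in> Basis" "c \<in> Basis"
    have "(\<Sum>v\<in>\<xi> ` I. (v \<bullet> b) * (v \<bullet> c)) = (1 + 1 / DIM('a)) * (b \<bullet> c)"
      using arg_cong[OF frame(2)[of b], of "\<lambda>s. s \<bullet> c"] by (simp add: inner_sum_left)
    then have "(\<integral>x. (x \<bullet> b) * (x \<bullet> c) \<partial>\<nu>) = (1 + 1 / DIM('a)) * (b \<bullet> c) / (DIM('a) + 1)"
      by (subst integral) (auto intro!: continuous_intros)
    also have "1 + 1 / real DIM('a) = real (DIM('a) + 1) / DIM('a)"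
      by (simp add: add_divide_distrib)
    also have "\<dots> * (b \<bullet> c) / real (DIM('a) + 1) = (b \<bullet> c) / DIM('a)"
      by (simp del: of_nat_add)
    finally show "(\<integral>x. (x \<bullet> b) * (x \<bullet> c) \<partial>\<nu>) =
        (if b = c then measure \<nu> (space \<nu>) / DIM('a) else 0)"
      using bc by (simp add: inner_Basis prob_space)
  qed
  moreover have "countable (\<xi> ` I)" using I(1) by (simp add: countable_finite)
  moreover have "emeasure \<nu> (\<xi> ` I) = 1"
    using \<xi> I(1) by (intro one countable_in_sphere_borel) (auto simp: countable_finite)
  ultimately show "\<nu> \<in> countable_designs 2"
    using prob sets \<xi> by (auto simp: countable_designs_2_iff)
  have mass: "measure \<nu> {x} = (if x \<in> \<xi> ` I then 1 / (DIM('a) + 1) else 0)" if x: "x \<in> sphere 0 1" for x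
  proof -
    have "{x} \<in> sets sphere_borel" using x by (intro countable_in_sphere_borel) auto
    then have m: "measure \<nu> {x} = card {i \<in> I. \<xi> i = x} / (DIM('a) + 1)"
      using emeasure[of "{x}"] I by (simp add: measure_def)
    show ?thesis
    proof (cases "x \<in> \<xi> ` I")
      case True
      then obtain i where "i \<in> I" "x = \<xi> i" by blast
      then have "{i \<in> I. \<xi> i = x} = {i}" using inj by (auto dest: inj_onD)
      with m True show ?thesis by simp
    next
      case False
      then have "{i \<in> I. \<xi> i = x} = {}" by auto
      with m False show ?thesis by simp
    qed
  qed
  have atoms: "atoms \<nu> = \<xi> ` I"
    using \<xi> by (auto simp: atoms_def mass split: if_splits)
  let ?N = "real DIM('a) + 1"
  have "power_sum \<theta> \<nu> = (\<Sum>x\<in>\<xi> ` I. ennreal (measure \<nu> {x} powr \<theta>))"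
    using I(1) by (simp add: power_sum_def atoms)
  also have "\<dots> = (\<Sum>x\<in>\<xi> ` I. ennreal ((1 / ?N) powr \<theta>))"
    using \<xi> by (intro sum.cong) (auto simp: mass subset_iff add.commute)
  also have "\<dots> = ennreal (\<Sum>x\<in>\<xi> ` I. (1 / ?N) powr \<theta>)" by (rule sum_ennreal) simp
  also have "(\<Sum>x\<in>\<xi> ` I. (1 / ?N) powr \<theta>) = ?N * (1 / ?N) powr \<theta>"
    using I by (simp add: card_image[OF inj] add.commute)
  also have "\<dots> = ?N powr (1 - \<theta>)"
    by (simp add: powr_diff powr_divide)
  finally show "power_sum \<theta> \<nu> = ennreal ((DIM('a) + 1) powr (1 - \<theta>))" by (simp add: add.commute)
qed

text \<open>Atoms of mass \<open>1 / (d + 1)\<close> each and total mass \<open>1\<close>: there are exactly \<open>d + 1\<close> of them.\<close>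

lemma equal_atoms_regular_simplex:
  fixes \<nu> :: "'a::euclidean_space measure"
  assumes \<nu>: "\<nu> \<in> countable_designs 2"
    and mass: "\<And>x. x \<in> atoms \<nu> \<Longrightarrow> measure \<nu> {x} = 1 / (DIM('a) + 1)"
  obtains \<xi> :: "nat \<Rightarrow> 'a" where "\<xi> ` {1..DIM('a) + 1} \<subseteq> sphere 0 1"
    "regular_simplex_vertices DIM('a) (\<xi> ` {1..DIM('a) + 1})"
    "is_dirac_average {1..DIM('a) + 1} \<xi> \<nu>"
proof -
  let ?N = "real DIM('a) + 1"
  let ?A = "atoms \<nu>"
  have N: "real (DIM('a) + 1) = ?N" "?N > 0" by auto
  from \<nu> obtain C where prob: "prob_space \<nu>" and sets: "sets \<nu> = sets sphere_borel"
    and C: "countable C" "C \<subseteq> sphere 0 1" "emeasure \<nu> C = 1" and iso: "isotropic \<nu>"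
    by (auto simp: countable_designs_2_iff)
  interpret prob_space \<nu> by (rule prob)
  note cA = atoms_of_countably_supported[OF prob sets C]
  have sphere: "?A \<subseteq> sphere 0 1" by (auto simp: atoms_def)
  have in_sets: "F \<in> sets \<nu>" if "F \<subseteq> ?A" for F
    unfolding sets using that sphere countable_subset[OF that cA(1)]
    by (intro countable_in_sphere_borel) auto
  have measure_F: "measure \<nu> F = card F / ?N" if F: "finite F" "F \<subseteq> ?A" for F
  proof -
    have "measure \<nu> F = (\<Sum>x\<in>F. measure \<nu> {x})"
      using F in_sets[of "{x}" for x]
      by (intro measure_eq_sum_singleton) (auto simp: emeasure_eq_measure)
    also have "\<dots> = (\<Sum>x\<in>F. 1 / ?N)"
      using F mass unfolding N(1) by (intro sum.cong) auto
    finally show ?thesis by simp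
  qed
  have fin: "finite ?A"
  proof (rule ccontr)
    assume "infinite ?A"
    then obtain F where F: "finite F" "card F = DIM('a) + 2" "F \<subseteq> ?A"
      using infinite_arbitrarily_large by blast
    have "measure \<nu> F > 1" using measure_F[OF F(1,3)] F(2) by simp
    then show False using prob_le_1[of F] by simp
  qed
  have card: "card ?A = DIM('a) + 1"
    using measure_F[OF fin subset_refl] cA(2) by (simp add: field_simps)
  then obtain \<xi> where \<xi>: "bij_betw \<xi> {1..DIM('a) + 1} ?A"
    using ex_bij_betw_nat_finite_1[OF fin] by metis
  then have img: "\<xi> ` {1..DIM('a) + 1} = ?A" and inj: "inj_on \<xi> {1..DIM('a) + 1}"
    by (auto simp: bij_betw_def)
  have "regular_simplex_vertices DIM('a) ?A"
  proof (rule regular_simplex_vertices_of_inner[OF sphere fin card])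
    fix x y assume "x \<in> ?A" "y \<in> ?A" "x \<noteq> y"
    then show "x \<bullet> y = - 1 / DIM('a)"
      using mass[of x] by (intro isotropic_atoms_inner[OF prob sets iso]) (auto simp: atoms_def)
  qed
  moreover have "is_dirac_average {1..DIM('a) + 1} \<xi> \<nu>"
    unfolding is_dirac_average_iff_card[OF finite_atLeastAtMost]
  proof (intro conjI ballI sets)
    fix B assume B: "B \<in> sets (sphere_borel :: 'a measure)"
    have "measure \<nu> B = measure \<nu> (B \<inter> ?A)"
    proof -
      have "AE x in \<nu>. x \<in> ?A" using cA(2) in_sets[OF subset_refl] by (intro AE_prob_1)
      then show ?thesis
        using B in_sets[of "B \<inter> ?A"] sets by (intro finite_measure_eq_AE) auto
    qed
    also have "\<dots> = card (B \<inter> ?A) / ?N" using fin by (intro measure_F) auto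
    also have "card (B \<inter> ?A) = card {i \<in> {1..DIM('a) + 1}. \<xi> i \<in> B}"
    proof -
      have "B \<inter> ?A = \<xi> ` {i \<in> {1..DIM('a) + 1}. \<xi> i \<in> B}" unfolding img[symmetric] by auto
      moreover have "inj_on \<xi> {i \<in> {1..DIM('a) + 1}. \<xi> i \<in> B}"
        using inj by (rule inj_on_subset) auto
      ultimately show ?thesis by (simp only: card_image)
    qed
    finally show "emeasure \<nu> B =
        ennreal (card {i \<in> {1..DIM('a) + 1}. \<xi> i \<in> B} / card {1..DIM('a) + 1})"
      by (simp add: emeasure_eq_measure add.commute)
  qed
  ultimately show ?thesis using img sphere that[of \<xi>] by simp
qed

section \<open>The optimal designs\<close>

theorem proposition3p2:
  fixes n :: nat and \<theta> :: real
  assumes dim: "DIM('a::euclidean_space) = n + 1"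
    and theta: "0 < \<theta>" "\<theta> < 1"
  shows "Theta TYPE('a) 2 \<theta> = ennreal ((real n + 2) powr (1 - \<theta>)) \<and>
    (\<forall>\<nu> :: 'a measure.
       Theta_achieved_at 2 \<theta> \<nu> \<longleftrightarrow>
       (\<exists>\<xi> :: nat \<Rightarrow> 'a.
          (\<forall>i\<in>{1..n + 2}. \<xi> i \<in> sphere 0 1) \<and>
          regular_simplex_vertices (n + 1) (\<xi> ` {1..n + 2}) \<and>
          is_dirac_average {1..n + 2} \<xi> \<nu>))"
proof -
  let ?K = "ennreal ((real n + 2) powr (1 - \<theta>))"
  have d: "DIM('a) + 1 = n + 2" "real (DIM('a) + 1) = real n + 2" using dim by auto
  let ?S = "\<lambda>(\<xi> :: nat \<Rightarrow> 'a) \<nu>. (\<forall>i\<in>{1..n + 2}. \<xi> i \<in> sphere 0 1) \<and>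
          regular_simplex_vertices (n + 1) (\<xi> ` {1..n + 2}) \<and> is_dirac_average {1..n + 2} \<xi> \<nu>"
  have simplex: "\<nu> \<in> countable_designs 2 \<and> power_sum \<theta> \<nu> = ?K" if "?S \<xi> \<nu>" for \<xi> \<nu>
  proof -
    have "finite {1..n + 2}" "card {1..n + 2} = DIM('a) + 1" "\<xi> ` {1..n + 2} \<subseteq> sphere 0 1"
      "regular_simplex_vertices DIM('a) (\<xi> ` {1..n + 2})" "is_dirac_average {1..n + 2} \<xi> \<nu>"
      using that dim by auto
    from regular_simplex_average[OF this] show ?thesis unfolding d(2) by blast
  qed
  have lower: "?K \<le> power_sum \<theta> \<nu>" if "\<nu> \<in> countable_designs 2" for \<nu> :: "'a measure"
    using power_sum_lower_bound(1)[OF that theta(2)] unfolding d(2) .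
  obtain V :: "'a set" where V: "V \<subseteq> sphere 0 1" "regular_simplex_vertices DIM('a) V"
    by (rule exists_regular_simplex)
  have card: "card V = n + 2" using V(2) dim by (simp add: regular_simplex_vertices_def)
  then have "finite V" by (metis card.infinite add_is_0 zero_neq_numeral)
  then obtain \<xi> where "bij_betw \<xi> {1..n + 2} V"
    using ex_bij_betw_nat_finite_1 card by metis
  then have \<xi>: "\<xi> ` {1..n + 2} = V" by (simp add: bij_betw_def)
  let ?\<nu> = "distr (uniform_count_measure {1..n + 2}) sphere_borel \<xi>"
  have "is_dirac_average {1..n + 2} \<xi> ?\<nu>"
    using \<xi> V(1) by (subst is_dirac_average_iff_distr) auto
  then have "?S \<xi> ?\<nu>" using \<xi> V dim by auto
  then have att: "?\<nu> \<in> countable_designs 2" "power_sum \<theta> ?\<nu> = ?K" using simplex by blast+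
  have Theta: "Theta TYPE('a) 2 \<theta> = ?K"
    unfolding Theta_def
  proof (rule antisym)
    show "(INF \<nu>\<in>(countable_designs 2 :: 'a measure set). power_sum \<theta> \<nu>) \<le> ?K"
      using INF_lower[OF att(1), of "power_sum \<theta>"] att(2) by simp
    show "?K \<le> (INF \<nu>\<in>(countable_designs 2 :: 'a measure set). power_sum \<theta> \<nu>)"
      by (intro INF_greatest lower)
  qed
  have "Theta_achieved_at 2 \<theta> \<nu> \<longleftrightarrow> (\<exists>\<xi>. ?S \<xi> \<nu>)" for \<nu>
  proof
    assume "Theta_achieved_at 2 \<theta> \<nu>"
    then have \<nu>: "\<nu> \<in> countable_designs 2" "power_sum \<theta> \<nu> = ennreal ((DIM('a) + 1) powr (1 - \<theta>))"
      unfolding d(2) by (auto simp: Theta_achieved_at_def Theta)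
    obtain \<xi> where "\<xi> ` {1..DIM('a) + 1} \<subseteq> sphere 0 1"
      "regular_simplex_vertices DIM('a) (\<xi> ` {1..DIM('a) + 1})"
      "is_dirac_average {1..DIM('a) + 1} \<xi> \<nu>"
      using equal_atoms_regular_simplex[OF \<nu>(1) power_sum_lower_bound(2)[OF \<nu>(1) theta(2) \<nu>(2)]] by blast
    then have "?S \<xi> \<nu>" unfolding d(1) dim by auto
    then show "\<exists>\<xi>. ?S \<xi> \<nu>" by blast
  next
    assume "\<exists>\<xi>. ?S \<xi> \<nu>"
    then show "Theta_achieved_at 2 \<theta> \<nu>"
      using simplex by (auto simp: Theta_achieved_at_def Theta)
  qed
  with Theta show ?thesis by blast
qed

end
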